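(* Let $n\ge 1$ and $T\ge 2$ be integers and let $G=([T],\mathcal{E})$ be a connected undirected graph. Let $D\in\{0,-1,+1\}^{|\mathcal{E}|\times T}$ be the incidence matrix of $G$ for some orientation of its edges, $L=D^\top D$ its Laplacian with eigenvalues $\lambda_1\ge\lambda_2\ge\cdots\ge\lambda_{T-1}\ge\lambda_T=0$, and $M:=D\otimes I_n$. For each $t\in[T]$ let $C_t\in\mathbb{R}^{m_t\times n}$, $x_t\in\mathbb{R}^n$, and observe $y_t=C_tx_t+\eta_t$. Let $x\in\mathbb{R}^{nT}$ and $\eta$ be the column-stackings of the $x_t$ and of the $\eta_t$, $y$ the stacking of the $y_t$, $C=\mathrm{blockdiag}(C_1,\dots,C_T)\in\mathbb{R}^{(\sum_t m_t)\times nT}$, and $O_T:=[C_1^\top\ C_2^\top\ \cdots\ C_T^\top]^\top$ (so $O_T^\top O_T=\sum_{t=1}^T C_t^\top C_t$). Assume $\lambda_{\min}(O_T^\top O_T)>0$, that $\eta$ is a centered $\sigma$-subgaussian random vector, and that $\|Mx\|_2^2\le S_T$. Let $b_1,b_2,b_3>0$ satisfy $$\lambda_{T-1}\ge b_1,\qquad \frac{\lambda_{\min}(O_T^\top O_T)}{T}\ge b_2,\qquad 2\|C\|_2\frac{\lambda_{\max}^{1/2}(O_T^\top O_T)}{\sqrt T}\le b_3.$$ Define, for $\mu>0$, $$\overline{\lambda'}(\mu)=\begin{cases}\dfrac{b_2^2}{2(b_2^2+b_3^2)}\mu b_1, & \text{if } \mu b_1<b_2+\dfrac{b_3^2-b_2^2}{2b_2},\\[2mm]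 \dfrac14\Big(1-\dfrac{\mu b_1-b_2}{\sqrt{b_3^2+(\mu b_1-b_2)^2}}\Big)\mu b_1+\dfrac{b_2}{4}+\dfrac{b_2(\mu b_1-b_2)-b_3^2}{4\sqrt{b_3^2+(\mu b_1-b_2)^2}}, & \text{if } \mu b_1\ge b_2+\dfrac{b_3^2-b_2^2}{2b_2},\end{cases}$$ and $\overline{\lambda}(\mu):=\max\{\overline{\lambda'}(\mu),\lambda_{\min}(C^\top C)\}$. Let $\mu>0$ and let $\hat x$ be the (unique) minimizer over $z\in\mathbb{R}^{nT}$ of $\frac12\|y-Cz\|_2^2+\frac{\mu}{2}\|Mz\|_2^2$. Then: (1) $\lambda_{\min}(\mu M^\top M+C^\top C)\ge\overline{\lambda}(\mu)$, and $\overline{\lambda'}(\mu)>0$; moreover, if $\mu b_1\ge b_2+\frac{b_3^2}{b_2}$ then $\overline{\lambda'}(\mu)\ge\frac{b_2}{4}$. (2) For any $\delta\in(0,e^{-1})$, with probability at least $1-\delta$, $$\|\hat x-x\|_2^2\le\frac{4\mu}{\overline{\lambda}(\mu)}S_T+40n\sigma^2\|C\|_2^2\Big(\sum_{t=1}^{T-1}\frac{1}{(\overline{\lambda}(\mu)+\mu\lambda_t)^2}+\frac{1}{\overline{\lambda}^2(\mu)}\Big)\log\Big(\frac1\delta\Big).$$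
   Context: A random vector $Y\in\mathbb{R}^N$ is centered $\sigma$-subgaussian if $\mathbb{E}[Y]=0$ and $\mathbb{E}[e^{s\,u^\top Y}]\le e^{s^2\sigma^2/2}$ for all $s\in\mathbb{R}$ and all unit vectors $u\in\mathbb{R}^N$. Eigenvalues of symmetric matrices are ordered decreasingly; $\lambda_{\min},\lambda_{\max}$ denote the smallest and largest eigenvalue; $\|\cdot\|_2$ of a matrix is its spectral norm. $\otimes$ is the Kronecker product. *)

theory Defs
  imports "Jordan_Normal_Form.Char_Poly" "HOL-Probability.Probability"
begin

text \<open>Euclidean norm of a real Matrix.vector.\<close>
definition vnorm :: "real Matrix.vec \<Rightarrow> real" where
  "vnorm v = sqrt (\<Sum>i<dim_vec v. (vec_index v i)^2)"

text \<open>Smallest / largest eigenvalue (used for symmetric real matrices, whose eigenvalues are real).\<close>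
definition lambda_min :: "real mat \<Rightarrow> real" where
  "lambda_min A = Min {k. eigenvalue A k}"

definition lambda_max :: "real mat \<Rightarrow> real" where
  "lambda_max A = Max {k. eigenvalue A k}"

text \<open>Eigenvalues of a (real symmetric) matrix, with multiplicity, in decreasing order:
  the decreasingly sorted list of roots of the characteristic polynomial.\<close>
definition eigvals_desc :: "real mat \<Rightarrow> real list" where
  "eigvals_desc A = (THE ls. length ls = dim_row A \<and> sorted_wrt (\<ge>) ls \<and>
      char_poly A = (\<Prod>a\<leftarrow>ls. [:-a, 1:]))"

text \<open>Spectral (operator) norm.\<close>
definition spec_norm :: "real mat \<Rightarrow> real" where
  "spec_norm A = Sup {vnorm (A *\<^sub>v v) | v. v \<in> carrier_vec (dim_col A) \<and> vnorm v = 1}"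

text \<open>Kronecker product; row index (i,k) is i * dim_row B + k, similarly for columns.\<close>
definition kron :: "real mat \<Rightarrow> real mat \<Rightarrow> real mat" where
  "kron A B = Matrix.mat (dim_row A * dim_row B) (dim_col A * dim_col B)
     (\<lambda>(r,c). index_mat A (r div dim_row B, c div dim_col B) * index_mat B (r mod dim_row B, c mod dim_col B))"

text \<open>Oriented edge list of a simple undirected graph on vertex set [T] = {0..<T}:
  each edge {a,b} appears exactly once, oriented as (a,b).\<close>
definition oriented_simple_graph :: "nat \<Rightarrow> (nat \<times> nat) list \<Rightarrow> bool" where
  "oriented_simple_graph T es \<longleftrightarrow>
     distinct (map (\<lambda>(a,b). {a,b}) es) \<and> (\<forall>(a,b)\<in>set es. a < T \<and> b < T \<and> a \<noteq> b)"

definition graph_connected :: "nat \<Rightarrow> (nat \<times> nat) list \<Rightarrow> bool" where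
  "graph_connected T es \<longleftrightarrow> (\<forall>u<T. \<forall>v<T. (u,v) \<in> (set es \<union> (set es)\<inverse>)\<^sup>*)"

text \<open>Incidence matrix (rows = oriented edges, columns = vertices).\<close>
definition incidence_mat :: "nat \<Rightarrow> (nat \<times> nat) list \<Rightarrow> real mat" where
  "incidence_mat T es = Matrix.mat (length es) T
     (\<lambda>(k,t). if t = fst (es ! k) then 1 else if t = snd (es ! k) then -1 else 0)"

text \<open>Row offsets of the blocks: offs m t = m_0 + ... + m_(t-1) (blocks indexed 0..T-1).\<close>
definition offs :: "(nat \<Rightarrow> nat) \<Rightarrow> nat \<Rightarrow> nat" where
  "offs m t = (\<Sum>s<t. m s)"

text \<open>C = blockdiag(C_0,...,C_(T-1)), each C_t of size m_t x n.\<close>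
definition blockdiag :: "nat \<Rightarrow> nat \<Rightarrow> (nat \<Rightarrow> nat) \<Rightarrow> (nat \<Rightarrow> real mat) \<Rightarrow> real mat" where
  "blockdiag T n m Cs = Matrix.mat (offs m T) (n * T)
     (\<lambda>(r,c). let t = c div n in
        if offs m t \<le> r \<and> r < offs m (Suc t) then index_mat (Cs t) (r - offs m t, c mod n) else 0)"

text \<open>O_T = vertical stacking of C_0,...,C_(T-1).\<close>
definition vstack :: "nat \<Rightarrow> nat \<Rightarrow> (nat \<Rightarrow> nat) \<Rightarrow> (nat \<Rightarrow> real mat) \<Rightarrow> real mat" where
  "vstack T n m Cs = Matrix.mat (offs m T) n
     (\<lambda>(r,c). let t = (LEAST t. r < offs m (Suc t)) in index_mat (Cs t) (r - offs m t, c))"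

text \<open>The lower-bound function lambda-bar-prime.\<close>
definition lam_bar' :: "real \<Rightarrow> real \<Rightarrow> real \<Rightarrow> real \<Rightarrow> real" where
  "lam_bar' b1 b2 b3 \<mu> =
    (if \<mu> * b1 < b2 + (b3^2 - b2^2) / (2 * b2)
     then b2^2 / (2 * (b2^2 + b3^2)) * \<mu> * b1
     else 1/4 * (1 - (\<mu> * b1 - b2) / sqrt (b3^2 + (\<mu> * b1 - b2)^2)) * \<mu> * b1 + b2 / 4
          + (b2 * (\<mu> * b1 - b2) - b3^2) / (4 * sqrt (b3^2 + (\<mu> * b1 - b2)^2)))"

text \<open>Centered sigma-subgaussian random vector in R^N on probability space P.\<close>
definition centered_subgaussian :: "'a measure \<Rightarrow> ('a \<Rightarrow> real Matrix.vec) \<Rightarrow> nat \<Rightarrow> real \<Rightarrow> bool" where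
  "centered_subgaussian P Y N \<sigma> \<longleftrightarrow>
     (\<forall>\<omega>\<in>space P. Y \<omega> \<in> carrier_vec N) \<and>
     (\<forall>i<N. integrable P (\<lambda>\<omega>. vec_index (Y \<omega>) i) \<and> (\<integral>\<omega>. vec_index (Y \<omega>) i \<partial>P) = 0) \<and>
     (\<forall>u\<in>carrier_vec N. vnorm u = 1 \<longrightarrow> (\<forall>s::real.
        integrable P (\<lambda>\<omega>. exp (s * scalar_prod u (Y \<omega>))) \<and>
        (\<integral>\<omega>. exp (s * scalar_prod u (Y \<omega>)) \<partial>P) \<le> exp (s^2 * \<sigma>^2 / 2)))"

text \<open>Regularized least-squares objective and its minimizer.\<close>
definition rls_obj :: "real mat \<Rightarrow> real mat \<Rightarrow> real \<Rightarrow> real Matrix.vec \<Rightarrow> real Matrix.vec \<Rightarrow> real" where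
  "rls_obj C M \<mu> y z = 1/2 * (vnorm (y - C *\<^sub>v z))^2 + \<mu>/2 * (vnorm (M *\<^sub>v z))^2"

definition rls_est :: "real mat \<Rightarrow> real mat \<Rightarrow> real \<Rightarrow> real Matrix.vec \<Rightarrow> real Matrix.vec" where
  "rls_est C M \<mu> y = (THE z. z \<in> carrier_vec (dim_col C) \<and>
      (\<forall>w\<in>carrier_vec (dim_col C). rls_obj C M \<mu> y z \<le> rls_obj C M \<mu> y w))"

end

theory Submission
  imports Defs "Jordan_Normal_Form.Spectral_Radius"
begin

text \<open>
  Split a vector into its average over the vertices and the orthogonal rest, of norms \<open>\<alpha>\<close> and
  \<open>\<beta>\<close>. The spectral gap of the Laplacian bounds the penalty below by \<open>\<mu> b1 \<beta>\<^sup>2\<close>, and the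
  observation term is at least \<open>max 0 (b2 \<alpha>\<^sup>2 - b3 \<alpha> \<beta>)\<close>; minimising the sum over the circle
  gives the eigenvalue bound (even with a factor 2 to spare).

  For the estimator, the error solves the normal equations, and in an orthonormal eigenbasis of
  \<open>A = \<mu> M\<^sup>T M + C\<^sup>T C\<close> it splits into a bias of squared norm at most \<open>\<mu> S_T / lbar\<close> and linear
  functionals of the noise whose variance proxies add up to at most
  \<open>\<sigma>\<^sup>2 (spec_norm C)\<^sup>2 tr (A\<^sup>-\<^sup>2)\<close>. Since \<open>A\<close> dominates both \<open>lbar I\<close> and \<open>\<mu> M\<^sup>T M\<close>, it dominates
  their mean, which bounds the trace. Only the sum of the variance proxies enters
  the tail bound, because \<open>ln (1 / \<delta>) \<ge> 1\<close>.
\<close>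

no_notation inner (infix "\<bullet>" 70)
no_notation vec_nth (infixl "$" 90)
hide_const (open) Finite_Cartesian_Product.vec Finite_Cartesian_Product.mat Finite_Cartesian_Product.row Finite_Cartesian_Product.column
hide_type (open) Finite_Cartesian_Product.vec

subsection \<open>The spectral theorem for real symmetric matrices\<close>

text \<open>Without the cut-off at 0, the form \<open>\<mu> * b1 * \<beta>^2 + b2 * \<alpha>^2 - b3
  * \<alpha> * \<beta>\<close> is indefinite for small \<mu>. The cut-off acts where
  \<open>b2 * \<alpha> \<le> b3 * \<beta>\<close>. The first branch of \<open>lam_bar'\<close> is
  half the value of the form at the unit vector on the boundary line, the second is half the smaller
  eigenvalue of the form. At the threshold the eigenvector lies on that line, and both branches
  equal \<open>b2 / 4\<close>.

  The subgaussian hypothesis controls one linear functional of the noise at a time. The functionals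
  belonging to different eigenvectors may be dependent, so the exponential moment of their sum of
  squares does not factor. Jensen's inequality still bounds it, at the rate of a single functional
  carrying the total variance proxy.

  The constant 40 is 2 * 5 * 4: the 2 comes from squaring the difference of noise and bias, the 5
  from the tail bound, and the 4 from bounding \<open>A\<close> below by half of
  \<open>lbar I + \<mu> M\<^sup>T M\<close> before inverting and squaring.\<close>

lemma vnorm_sq: "(vnorm v)^2 = v \<bullet> v"
  by (simp add: vnorm_def scalar_prod_def sum_nonneg power2_eq_square atLeast0LessThan)

lemma scalar_prod_self_nonneg: "0 \<le> (v :: real vec) \<bullet> v"
  by (simp add: scalar_prod_def sum_nonneg)

lemma scalar_prod_self_eq_0:
  assumes "(v :: real vec) \<in> carrier_vec N" "v \<bullet> v = 0"
  shows "v = 0\<^sub>v N"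
proof (rule eq_vecI)
  fix i assume i: "i < dim_vec (0\<^sub>v N :: real vec)"
  have "\<forall>i\<in>{0..<dim_vec v}. v $ i * v $ i = 0"
    using assms(2) unfolding scalar_prod_def by (subst (asm) sum_nonneg_eq_0_iff) auto
  with i assms(1) show "v $ i = 0\<^sub>v N $ i" by auto
qed (use assms in auto)

lemma scalar_prod_mult_mat_vec_swap:
  assumes "(A :: 'b :: comm_semiring_0 mat) \<in> carrier_mat m N" "z \<in> carrier_vec N" "w \<in> carrier_vec m"
  shows "w \<bullet> (A *\<^sub>v z) = (transpose_mat A *\<^sub>v w) \<bullet> z"
  using transpose_vec_mult_scalar[OF assms] by simp

text \<open>Over the complex numbers the spectrum is nonempty. For an eigenvector \<open>w\<close>
  with value \<open>z\<close>, moving the real symmetric matrix across the product of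
  \<open>w\<close> with its conjugate gives \<open>conjugate z = z\<close>. The eigenvector itself
  may still be complex, so the return to \<open>A\<close> goes through a root of the characteristic
  polynomial.\<close>

lemma symmetric_has_eigenvalue:
  fixes A :: "real mat"
  assumes A: "A \<in> carrier_mat N N" and sym: "transpose_mat A = A" and N: "0 < N"
  shows "\<exists>a. eigenvalue A a"
proof -
  let ?c = "map_mat complex_of_real A"
  have cA: "?c \<in> carrier_mat N N" using A by auto
  obtain z where ev: "eigenvalue ?c z"
    using spectrum_non_empty[OF cA N] by (auto simp: spectrum_def)
  then obtain w where w: "w \<in> carrier_vec N" "w \<noteq> 0\<^sub>v N" "?c *\<^sub>v w = z \<cdot>\<^sub>v w"
    using cA by (auto simp: eigenvalue_def eigenvector_def)
  have cw: "conjugate w \<in> carrier_vec N" using w by auto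
  have symc: "transpose_mat ?c = ?c" by (simp add: map_mat_transpose sym)
  have conj_real: "conjugate (?c *\<^sub>v w) = ?c *\<^sub>v conjugate w"
    using w(1) A by (intro eq_vecI) (auto simp: scalar_prod_def conjugate_complex_def)
  have "conjugate z * (w \<bullet> conjugate w) = w \<bullet> (?c *\<^sub>v conjugate w)"
    using w cw unfolding conj_real[symmetric] w(3) by (simp add: conjugate_smult_vec)
  also have "\<dots> = (?c *\<^sub>v w) \<bullet> conjugate w"
    using scalar_prod_mult_mat_vec_swap[OF cA cw w(1)] symc by simp
  also have "\<dots> = z * (w \<bullet> conjugate w)"
    using w cw by simp
  finally have "conjugate z = z"
    using conjugate_square_eq_0_vec[OF w(1)] w(2) by simp
  then obtain a where za: "z = of_real a"
    by (metis conjugate_complex_def complex_is_Real_iff Reals_cases Reals_cnj_iff)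
  have "poly (char_poly ?c) z = 0" using ev eigenvalue_root_char_poly[OF cA] by auto
  then have "poly (map_poly of_real (char_poly A)) (complex_of_real a) = 0"
    by (simp add: za of_real_hom.char_poly_hom[OF A])
  then have "poly (char_poly A) a = 0"
    by simp
  then show ?thesis using eigenvalue_root_char_poly[OF A] by auto
qed

text \<open>A Householder reflection.\<close>
lemma orthogonal_mat_first_column:
  fixes v :: "real vec"
  assumes v: "v \<in> carrier_vec (Suc N)" and unit: "v \<bullet> v = 1"
  shows "\<exists>Q \<in> carrier_mat (Suc N) (Suc N). transpose_mat Q * Q = 1\<^sub>m (Suc N) \<and> col Q 0 = v"
proof (cases "v = unit_vec (Suc N) 0")
  case True
  then show ?thesis by (intro bexI[of _ "1\<^sub>m (Suc N)"]) auto
next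
  case False
  \<comment> \<open>The reflection in the hyperplane orthogonal to \<open>w\<close> exchanges the
    first unit vector and \<open>v\<close>; it degenerates for \<open>w = 0\<close>, hence the case
    split. Since both vectors have norm 1, \<open>w \<bullet> w = - 2 * w $ 0\<close>, and this
    makes the first column come out as \<open>v\<close>.\<close>
  define w where "w = v - unit_vec (Suc N) 0"
  define c where "c = 2 / (w \<bullet> w)"
  define Q where "Q = mat (Suc N) (Suc N) (\<lambda>(i,j). (if i = j then 1 else 0) - c * w $ i * w $ j)"
  have w: "w \<in> carrier_vec (Suc N)" using v by (auto simp: w_def)
  have w0: "w \<noteq> 0\<^sub>v (Suc N)"
  proof
    assume *: "w = 0\<^sub>v (Suc N)"
    have "v = unit_vec (Suc N) 0"
    proof (rule eq_vecI)
      fix i assume "i < dim_vec (unit_vec (Suc N) 0 :: real vec)"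
      with arg_cong[OF *, of "\<lambda>w. w $ i"] v show "v $ i = unit_vec (Suc N) 0 $ i"
        by (auto simp: w_def)
    qed (use v in auto)
    with False show False by simp
  qed
  then have ww: "w \<bullet> w \<noteq> 0" using scalar_prod_self_eq_0[OF w] by blast
  have wi: "w $ i = v $ i - (if i = 0 then 1 else 0)" if "i < Suc N" for i
    using v that by (auto simp: w_def)
  have "w \<bullet> w = w \<bullet> v - w \<bullet> unit_vec (Suc N) 0"
    using w v by (subst (2) w_def, subst scalar_prod_minus_distrib[of _ "Suc N"]) auto
  also have "\<dots> = v \<bullet> v - unit_vec (Suc N) 0 \<bullet> v - w $ 0"
    using w v by (subst w_def, subst minus_scalar_prod_distrib[of _ "Suc N"]) auto
  also have "\<dots> = 2 - 2 * v $ 0"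
    using unit v by (simp add: wi)
  finally have www: "w \<bullet> w = - 2 * w $ 0" by (simp add: wi)
  then have cw: "c * w $ 0 = -1" using ww by (simp add: c_def field_simps)
  have Qc: "Q \<in> carrier_mat (Suc N) (Suc N)" by (auto simp: Q_def)
  moreover have "col Q 0 = v"
  proof (rule eq_vecI)
    fix i assume "i < dim_vec v"
    then have i: "i < Suc N" using v by auto
    have "c * w $ i * w $ 0 = - w $ i" using cw by (metis mult.assoc mult.commute mult_minus1)
    then show "col Q 0 $ i = v $ i" using i by (simp add: Q_def wi)
  qed (use v in \<open>auto simp: Q_def\<close>)
  moreover have "transpose_mat Q * Q = 1\<^sub>m (Suc N)"
  proof (rule eq_matI)
    fix i j assume "i < dim_row (1\<^sub>m (Suc N) :: real mat)" "j < dim_col (1\<^sub>m (Suc N) :: real mat)"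
    then have ij: "i < Suc N" "j < Suc N" by auto
    have dw: "dim_vec w = Suc N" using w by auto
    have "(transpose_mat Q * Q) $$ (i,j) = (\<Sum>k<Suc N. ((if k = i then 1 else 0) - c * w $ k * w $ i) * ((if k = j then 1 else 0) - c * w $ k * w $ j))"
      using ij by (simp add: Q_def scalar_prod_def atLeast0LessThan del: sum.lessThan_Suc)
    also have "\<dots> = (\<Sum>k<Suc N. (if k = i then (if i = j then 1 else 0) - c * w $ i * w $ j else 0)
        + (if k = j then - c * w $ j * w $ i else 0) + c * c * w $ i * w $ j * (w $ k * w $ k))"
      by (intro sum.cong refl) (auto simp: algebra_simps)
    also have "\<dots> = ((if i = j then 1 else 0) - c * w $ i * w $ j) - c * w $ j * w $ i + c * c * w $ i * w $ j * (w \<bullet> w)"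
      using ij by (simp add: sum.distrib sum_distrib_left[symmetric] scalar_prod_def dw atLeast0LessThan del: sum.lessThan_Suc)
    also have "c * c * w $ i * w $ j * (w \<bullet> w) = 2 * c * w $ i * w $ j"
      using ww by (simp add: c_def)
    finally show "(transpose_mat Q * Q) $$ (i,j) = 1\<^sub>m (Suc N) $$ (i,j)" using ij by simp
  qed (auto simp: Q_def)
  ultimately show ?thesis by blast
qed

lemma exists_unit_eigenvector:
  fixes A :: "real mat"
  assumes A: "A \<in> carrier_mat N N" and "transpose_mat A = A" "0 < N"
  shows "\<exists>v a. v \<in> carrier_vec N \<and> v \<bullet> v = 1 \<and> A *\<^sub>v v = a \<cdot>\<^sub>v v"
proof -
  obtain a where "eigenvalue A a" using symmetric_has_eigenvalue[OF assms] by blast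
  then obtain w where w: "w \<in> carrier_vec N" "w \<noteq> 0\<^sub>v N" "A *\<^sub>v w = a \<cdot>\<^sub>v w"
    using A by (auto simp: eigenvalue_def eigenvector_def)
  have pos: "0 < w \<bullet> w"
    using scalar_prod_self_nonneg[of w] scalar_prod_self_eq_0[OF w(1)] w(2) by force
  let ?v = "(1 / sqrt (w \<bullet> w)) \<cdot>\<^sub>v w"
  have "?v \<bullet> ?v = 1 / sqrt (w \<bullet> w) * (1 / sqrt (w \<bullet> w) * (w \<bullet> w))"
    using w by simp
  also have "\<dots> = 1" using pos by (simp add: field_simps)
  finally have "?v \<bullet> ?v = 1" .
  moreover have "A *\<^sub>v ?v = a \<cdot>\<^sub>v ?v"
    using w A by (simp add: mult_mat_vec[OF A w(1)] smult_smult_assoc mult.commute)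
  ultimately show ?thesis using w(1) by (intro exI[of _ ?v] exI[of _ a]) auto
qed

text \<open>Deflation: conjugating by an orthogonal matrix whose first column is a unit eigenvector
  clears the first column below the diagonal, symmetry clears the first row, and the induction
  hypothesis handles the remaining block.\<close>

lemma spectral_theorem_mat:
  fixes A :: "real mat"
  assumes "A \<in> carrier_mat N N" "transpose_mat A = A"
  shows "\<exists>U \<in> carrier_mat N N. transpose_mat U * U = 1\<^sub>m N \<and>
    diagonal_mat (transpose_mat U * A * U)"
  using assms
proof (induction N arbitrary: A)
  case 0
  then show ?case by (intro bexI[of _ "1\<^sub>m 0"]) (auto simp: diagonal_mat_def)
next
  case (Suc N)
  note A = Suc.prems(1) and sym = Suc.prems(2)
  obtain v a where v: "v \<in> carrier_vec (Suc N)" "v \<bullet> v = 1" "A *\<^sub>v v = a \<cdot>\<^sub>v v"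
    using exists_unit_eigenvector[OF A sym] by auto
  obtain Q where Q: "Q \<in> carrier_mat (Suc N) (Suc N)" "transpose_mat Q * Q = 1\<^sub>m (Suc N)" "col Q 0 = v"
    using orthogonal_mat_first_column[OF v(1,2)] by blast
  let ?QT = "transpose_mat Q"
  have QT: "?QT \<in> carrier_mat (Suc N) (Suc N)" using Q by auto
  define B where "B = ?QT * A * Q"
  have B: "B \<in> carrier_mat (Suc N) (Suc N)" using Q A by (auto simp: B_def)
  have symB: "transpose_mat B = B"
    using Q QT A sym by (simp add: B_def transpose_mult[of _ "Suc N" "Suc N" _ "Suc N"] assoc_mult_mat[of _ "Suc N" "Suc N" _ "Suc N" _ "Suc N"])
  have colB: "col B 0 = a \<cdot>\<^sub>v unit_vec (Suc N) 0"
  proof -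
    have "col B 0 = (?QT * A) *\<^sub>v v"
      unfolding B_def using Q A by (subst col_mult2[of _ "Suc N" "Suc N" _ "Suc N"]) auto
    also have "\<dots> = ?QT *\<^sub>v (a \<cdot>\<^sub>v v)"
      using v A QT by (simp add: assoc_mult_mat_vec[of _ "Suc N" "Suc N" _ "Suc N"])
    also have "\<dots> = a \<cdot>\<^sub>v (?QT *\<^sub>v col Q 0)"
      using v QT Q by (simp add: mult_mat_vec)
    also have "?QT *\<^sub>v col Q 0 = col (?QT * Q) 0"
      using Q by (subst col_mult2[of _ "Suc N" "Suc N" _ "Suc N"]) auto
    also have "\<dots> = unit_vec (Suc N) 0" using Q by simp
    finally show ?thesis .
  qed
  have B0: "B $$ (i,0) = (if i = 0 then a else 0)" if "i < Suc N" for i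
    using arg_cong[OF colB, of "\<lambda>v. v $ i"] that B by auto
  have B0': "B $$ (0,i) = (if i = 0 then a else 0)" if "i < Suc N" for i
    using B0[OF that] symB B that by (metis carrier_matD index_transpose_mat(1) zero_less_Suc)
  define A' where "A' = mat N N (\<lambda>(i,j). B $$ (Suc i, Suc j))"
  have A': "A' \<in> carrier_mat N N" by (auto simp: A'_def)
  have symA': "transpose_mat A' = A'"
  proof (rule eq_matI)
    fix i j assume "i < dim_row A'" "j < dim_col A'"
    then have "i < N" "j < N" using A' by auto
    then show "transpose_mat A' $$ (i,j) = A' $$ (i,j)"
      using symB B by (simp add: A'_def) (metis Suc_mono carrier_matD index_transpose_mat(1))
  qed (use A' in auto)
  obtain V where V: "V \<in> carrier_mat N N" "transpose_mat V * V = 1\<^sub>m N" "diagonal_mat (transpose_mat V * A' * V)"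
    using Suc.IH[OF A' symA'] by blast
  let ?a = "mat 1 1 (\<lambda>_. a)"
  let ?W = "four_block_mat (1\<^sub>m 1) (0\<^sub>m 1 N) (0\<^sub>m N 1) V"
  let ?WT = "four_block_mat (1\<^sub>m 1) (0\<^sub>m 1 N) (0\<^sub>m N 1) (transpose_mat V)"
  have Bblock: "B = four_block_mat ?a (0\<^sub>m 1 N) (0\<^sub>m N 1) A'"
    by (rule eq_matI) (use B A' B0 B0' in \<open>auto simp: A'_def\<close>)
  have WT: "transpose_mat ?W = ?WT"
    using V(1) by (subst transpose_four_block_mat[of _ 1 1 _ N _ N]) auto
  have W: "?W \<in> carrier_mat (Suc N) (Suc N)" "?WT \<in> carrier_mat (Suc N) (Suc N)"
    using V(1) four_block_carrier_mat[of "1\<^sub>m 1" 1 1 V N N] four_block_carrier_mat[of "1\<^sub>m 1" 1 1 "transpose_mat V" N N] by auto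
  have WW: "?WT * ?W = 1\<^sub>m (Suc N)"
    using V by (subst mult_four_block_mat[of _ 1 1 _ N _ N _ _ 1 _ N]) auto
  have WBW: "?WT * B * ?W = four_block_mat ?a (0\<^sub>m 1 N) (0\<^sub>m N 1) (transpose_mat V * A' * V)"
    using V A' unfolding Bblock
    by (subst mult_four_block_mat[of _ 1 1 _ N _ N _ _ 1 _ N]; (subst mult_four_block_mat[of _ 1 1 _ N _ N _ _ 1 _ N])?; auto)
  let ?U = "Q * ?W"
  have U: "?U \<in> carrier_mat (Suc N) (Suc N)" using Q W by auto
  have UT: "transpose_mat ?U = ?WT * ?QT"
    using transpose_mult[OF Q(1) W(1)] WT by simp
  have "transpose_mat ?U * ?U = ?WT * (?QT * Q) * ?W"
    using Q(1) QT W unfolding UT by (simp add: assoc_mult_mat[of _ "Suc N" "Suc N" _ "Suc N" _ "Suc N"])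
  also have "\<dots> = 1\<^sub>m (Suc N)" unfolding Q(2) right_mult_one_mat[OF W(2)] by (rule WW)
  finally have UU: "transpose_mat ?U * ?U = 1\<^sub>m (Suc N)" .
  have "transpose_mat ?U * A * ?U = ?WT * B * ?W"
    using Q(1) QT W A unfolding UT B_def by (simp add: assoc_mult_mat[of _ "Suc N" "Suc N" _ "Suc N" _ "Suc N"])
  moreover have "diagonal_mat (?WT * B * ?W)"
    using V(3) A' V(1) unfolding WBW diagonal_mat_def by auto
  ultimately show ?case using U UU by (intro bexI[of _ ?U]) auto
qed

section \<open>Orthonormal eigenbases and Parseval's identity\<close>

definition orthonormal_basis :: "nat \<Rightarrow> (nat \<Rightarrow> real vec) \<Rightarrow> bool" where
  "orthonormal_basis N v \<longleftrightarrow> (\<forall>i<N. v i \<in> carrier_vec N) \<and>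
     (\<forall>i<N. \<forall>j<N. v i \<bullet> v j = (if i = j then 1 else 0))"

definition orthonormal_eigenbasis :: "nat \<Rightarrow> real mat \<Rightarrow> (nat \<Rightarrow> real vec) \<Rightarrow> (nat \<Rightarrow> real) \<Rightarrow> bool" where
  "orthonormal_eigenbasis N A v a \<longleftrightarrow> orthonormal_basis N v \<and> (\<forall>i<N. A *\<^sub>v v i = a i \<cdot>\<^sub>v v i)"

lemma orthonormal_basisD:
  assumes "orthonormal_basis N v"
  shows "i < N \<Longrightarrow> v i \<in> carrier_vec N"
    "i < N \<Longrightarrow> j < N \<Longrightarrow> v i \<bullet> v j = (if i = j then 1 else 0)"
  using assms by (auto simp: orthonormal_basis_def)

text \<open>Completeness of the family comes from the count of \<open>N\<close> vectors in dimension
  \<open>N\<close>: a left inverse of a square matrix is also a right inverse. The third identity is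
  the one that \<open>parseval\<close> rests on.\<close>

lemma orthonormal_basis_mat:
  assumes "orthonormal_basis N v"
  defines "U \<equiv> mat_of_cols N (map v [0..<N])"
  shows "U \<in> carrier_mat N N" "transpose_mat U * U = 1\<^sub>m N" "U * transpose_mat U = 1\<^sub>m N"
proof -
  show U: "U \<in> carrier_mat N N" by (auto simp: U_def)
  have col: "col U i = v i" if "i < N" for i
    using that assms by (simp add: U_def orthonormal_basis_def)
  show *: "transpose_mat U * U = 1\<^sub>m N"
    by (rule eq_matI) (use U assms in \<open>auto simp: col orthonormal_basis_def\<close>)
  show "U * transpose_mat U = 1\<^sub>m N"
    using mat_mult_left_right_inverse[OF _ U *] U by auto
qed

lemma parseval:
  assumes v: "orthonormal_basis N v" and w: "w \<in> carrier_vec N" "z \<in> carrier_vec N"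
  shows "w \<bullet> z = (\<Sum>i<N. (v i \<bullet> w) * (v i \<bullet> z))"
proof -
  let ?U = "mat_of_cols N (map v [0..<N])"
  note U = orthonormal_basis_mat[OF v]
  have UT: "transpose_mat ?U \<in> carrier_mat N N" using U by auto
  have col: "col ?U i = v i" if "i < N" for i
    using that v by (simp add: orthonormal_basis_def)
  have "w \<bullet> z = w \<bullet> (?U * transpose_mat ?U *\<^sub>v z)" using U(3) w by simp
  also have "\<dots> = w \<bullet> (?U *\<^sub>v (transpose_mat ?U *\<^sub>v z))"
    using U(1) UT w by (simp add: assoc_mult_mat_vec[of _ N N _ N])
  also have "\<dots> = (transpose_mat ?U *\<^sub>v w) \<bullet> (transpose_mat ?U *\<^sub>v z)"
    using scalar_prod_mult_mat_vec_swap[OF U(1), of "transpose_mat ?U *\<^sub>v z" w] UT w by simp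
  also have "\<dots> = (\<Sum>i<N. (v i \<bullet> w) * (v i \<bullet> z))"
    using U(1) by (simp add: scalar_prod_def[of "_ *\<^sub>v _"] atLeast0LessThan col)
  finally show ?thesis .
qed

theorem spectral_theorem:
  fixes A :: "real mat"
  assumes A: "A \<in> carrier_mat N N" and sym: "transpose_mat A = A"
  obtains v a where "orthonormal_eigenbasis N A v a" "\<And>i j. i \<le> j \<Longrightarrow> j < N \<Longrightarrow> a j \<le> a i"
proof -
  obtain U where U: "U \<in> carrier_mat N N" "transpose_mat U * U = 1\<^sub>m N" "diagonal_mat (transpose_mat U * A * U)"
    using spectral_theorem_mat[OF assms] by blast
  let ?D = "transpose_mat U * A * U"
  have UT: "transpose_mat U \<in> carrier_mat N N" using U by auto
  have UU: "U * transpose_mat U = 1\<^sub>m N"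
    using mat_mult_left_right_inverse[OF UT U(1) U(2)] .
  have AU: "A * U = U * ?D"
  proof -
    have "U * ?D = (U * transpose_mat U) * (A * U)"
      using U(1) UT A by (simp add: assoc_mult_mat[of _ N N _ N _ N])
    then show ?thesis using UU U(1) A by simp
  qed
  have D: "?D \<in> carrier_mat N N" using U UT A by auto
  define b where "b i = ?D $$ (i,i)" for i
  have eig: "A *\<^sub>v col U i = b i \<cdot>\<^sub>v col U i" if i: "i < N" for i
  proof -
    have "A *\<^sub>v col U i = U *\<^sub>v col ?D i"
      using arg_cong[OF AU, of "\<lambda>B. col B i"] i col_mult2[OF A U(1)] col_mult2[OF U(1) D] by simp
    also have "col ?D i = b i \<cdot>\<^sub>v unit_vec N i"
    proof (rule eq_vecI)
      fix j assume "j < dim_vec (b i \<cdot>\<^sub>v unit_vec N i)"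
      then have j: "j < N" by simp
      have "col ?D i $ j = ?D $$ (j,i)" using i j D by auto
      also have "\<dots> = (b i \<cdot>\<^sub>v unit_vec N i) $ j"
        using U(3) i j D unfolding diagonal_mat_def b_def by (cases "i = j") auto
      finally show "col ?D i $ j = (b i \<cdot>\<^sub>v unit_vec N i) $ j" .
    qed (use D in auto)
    also have "U *\<^sub>v (b i \<cdot>\<^sub>v unit_vec N i) = b i \<cdot>\<^sub>v col U i"
      using i U(1) by (auto simp: mult_mat_vec intro!: eq_vecI)
    finally show ?thesis .
  qed
  have on: "col U i \<bullet> col U j = (if i = j then 1 else 0)" if "i < N" "j < N" for i j
    using arg_cong[OF U(2), of "\<lambda>B. B $$ (i,j)"] that U(1) by simp
  have carr: "col U i \<in> carrier_vec N" for i
    using U(1) col_dim[of U i] by simp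
  \<comment> \<open>Sorting the indices, rather than the eigenvalues, keeps each eigenvalue paired
    with its eigenvector; the negated key makes the order decreasing.\<close>
  define xs where "xs = sort_key (\<lambda>i. - b i) [0..<N]"
  have xs: "length xs = N" "distinct xs" "set xs = {0..<N}" "sorted (map (\<lambda>i. - b i) xs)"
    by (auto simp: xs_def)
  have lt: "xs ! i < N" if "i < N" for i using that xs by (metis atLeastLessThan_iff nth_mem)
  show ?thesis
  proof (rule that[of "\<lambda>i. col U (xs ! i)" "\<lambda>i. b (xs ! i)"])
    show "orthonormal_eigenbasis N A (\<lambda>i. col U (xs ! i)) (\<lambda>i. b (xs ! i))"
      using carr lt on eig xs by (auto simp: orthonormal_eigenbasis_def orthonormal_basis_def nth_eq_iff_index_eq)
    show "b (xs ! j) \<le> b (xs ! i)" if "i \<le> j" "j < N" for i j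
      using sorted_nth_mono[OF xs(4), of i j] that xs(1) by simp
  qed
qed

lemma orthonormal_eigenbasisD:
  assumes "orthonormal_eigenbasis N A v a"
  shows "orthonormal_basis N v"
    "i < N \<Longrightarrow> v i \<in> carrier_vec N"
    "i < N \<Longrightarrow> A *\<^sub>v v i = a i \<cdot>\<^sub>v v i"
  using assms by (auto simp: orthonormal_eigenbasis_def orthonormal_basis_def)

lemma eigenbasis_coeff:
  assumes v: "orthonormal_eigenbasis N A v a" and A: "A \<in> carrier_mat N N" "transpose_mat A = A"
    and z: "z \<in> carrier_vec N" and i: "i < N"
  shows "v i \<bullet> (A *\<^sub>v z) = a i * (v i \<bullet> z)"
  using scalar_prod_mult_mat_vec_swap[OF A(1) z, of "v i"] A(2) z i orthonormal_eigenbasisD(2,3)[OF v i] by simp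

lemma eigenbasis_quadratic_form:
  assumes v: "orthonormal_eigenbasis N A v a" and A: "A \<in> carrier_mat N N" "transpose_mat A = A"
    and z: "z \<in> carrier_vec N"
  shows "z \<bullet> (A *\<^sub>v z) = (\<Sum>i<N. a i * (v i \<bullet> z)^2)"
proof -
  have "z \<bullet> (A *\<^sub>v z) = (\<Sum>i<N. (v i \<bullet> z) * (v i \<bullet> (A *\<^sub>v z)))"
    using parseval[OF orthonormal_eigenbasisD(1)[OF v] z, of "A *\<^sub>v z"] A z by simp
  then show ?thesis
    by (simp add: eigenbasis_coeff[OF v A z] power2_eq_square mult_ac)
qed

lemma parseval_self:
  assumes "orthonormal_basis N v" "z \<in> carrier_vec N"
  shows "z \<bullet> z = (\<Sum>i<N. (v i \<bullet> z)^2)"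
  using parseval[OF assms(1,2,2)] by (simp add: power2_eq_square)

text \<open>An eigenvector has a nonzero coefficient along some \<open>v i\<close>, and comparing
  coefficients there forces \<open>k = a i\<close>. The image form shows that the set is finite, as
  \<open>Min\<close> and \<open>Max\<close> in \<open>lambda_min\<close> and
  \<open>lambda_max\<close> require.\<close>

lemma eigenvalues_eigenbasis:
  assumes v: "orthonormal_eigenbasis N A v a" and A: "A \<in> carrier_mat N N" "transpose_mat A = A"
  shows "{k. eigenvalue A k} = a ` {..<N}"
proof (intro Set.set_eqI iffI)
  fix k assume "k \<in> {k. eigenvalue A k}"
  then obtain w where w: "w \<in> carrier_vec N" "w \<noteq> 0\<^sub>v N" "A *\<^sub>v w = k \<cdot>\<^sub>v w"
    using A by (auto simp: eigenvalue_def eigenvector_def)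
  have "w \<bullet> w \<noteq> 0" using scalar_prod_self_eq_0 w by blast
  then obtain i where i: "i < N" "v i \<bullet> w \<noteq> 0"
    unfolding parseval_self[OF orthonormal_eigenbasisD(1)[OF v] w(1)]
    by (metis (no_types, lifting) lessThan_iff sum.neutral zero_power2)
  have "a i * (v i \<bullet> w) = k * (v i \<bullet> w)"
    using eigenbasis_coeff[OF v A w(1) i(1)] w(1) orthonormal_eigenbasisD(2)[OF v i(1)] by (simp only: w(3) scalar_prod_smult_distrib)
  then have "a i = k" using i(2) by simp
  then show "k \<in> a ` {..<N}" using i(1) by auto
next
  fix k assume "k \<in> a ` {..<N}"
  then obtain i where i: "i < N" "k = a i" by auto
  have "v i \<bullet> v i = 1" using orthonormal_basisD(2)[OF orthonormal_eigenbasisD(1)[OF v] i(1) i(1)] by simp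
  then have "v i \<noteq> 0\<^sub>v N" by auto
  then show "k \<in> {k. eigenvalue A k}"
    using orthonormal_eigenbasisD(2,3)[OF v i(1)] A i(2) by (auto simp: eigenvalue_def eigenvector_def)
qed

section \<open>Extreme eigenvalues as bounds of the quadratic form\<close>

lemma orthonormal_eigenbasis_exists:
  fixes A :: "real mat"
  assumes A: "A \<in> carrier_mat N N" "transpose_mat A = A"
  shows "\<exists>v a. orthonormal_eigenbasis N A v a"
  by (rule spectral_theorem[OF A]) blast

lemma lambda_min_le_quadratic_form:
  assumes A: "A \<in> carrier_mat N N" "transpose_mat A = A" and z: "z \<in> carrier_vec N"
  shows "lambda_min A * (z \<bullet> z) \<le> z \<bullet> (A *\<^sub>v z)"
proof -
  obtain v a where v: "orthonormal_eigenbasis N A v a" using orthonormal_eigenbasis_exists[OF A] by blast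
  have "lambda_min A \<le> a i" if "i < N" for i
    unfolding lambda_min_def eigenvalues_eigenbasis[OF v A] using that by auto
  then show ?thesis
    unfolding eigenbasis_quadratic_form[OF v A z] parseval_self[OF orthonormal_eigenbasisD(1)[OF v] z] sum_distrib_left
    by (intro sum_mono mult_right_mono) auto
qed

lemma quadratic_form_le_lambda_max:
  assumes A: "A \<in> carrier_mat N N" "transpose_mat A = A" and z: "z \<in> carrier_vec N"
  shows "z \<bullet> (A *\<^sub>v z) \<le> lambda_max A * (z \<bullet> z)"
proof -
  obtain v a where v: "orthonormal_eigenbasis N A v a" using orthonormal_eigenbasis_exists[OF A] by blast
  have "a i \<le> lambda_max A" if "i < N" for i
    unfolding lambda_max_def eigenvalues_eigenbasis[OF v A] using that by auto
  then show ?thesis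
    unfolding eigenbasis_quadratic_form[OF v A z] parseval_self[OF orthonormal_eigenbasisD(1)[OF v] z] sum_distrib_left
    by (intro sum_mono mult_right_mono) auto
qed

lemma lambda_min_greatest:
  assumes A: "A \<in> carrier_mat N N" "transpose_mat A = A" and N: "0 < N"
    and le: "\<And>z. z \<in> carrier_vec N \<Longrightarrow> c * (z \<bullet> z) \<le> z \<bullet> (A *\<^sub>v z)"
  shows "c \<le> lambda_min A"
proof -
  obtain v a where v: "orthonormal_eigenbasis N A v a" using orthonormal_eigenbasis_exists[OF A] by blast
  have "c \<le> a i" if i: "i < N" for i
  proof -
    have 1: "v i \<bullet> v i = 1" using orthonormal_basisD(2)[OF orthonormal_eigenbasisD(1)[OF v] i i] by simp
    then show ?thesis
      using le[of "v i"] orthonormal_eigenbasisD(2,3)[OF v i] by simp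
  qed
  then show ?thesis
    unfolding lambda_min_def eigenvalues_eigenbasis[OF v A] using N by (subst Min_ge_iff) auto
qed

section \<open>The characteristic polynomial and the ordered list of eigenvalues\<close>

lemma char_poly_eigenbasis:
  assumes v: "orthonormal_eigenbasis N A v a" and A: "A \<in> carrier_mat N N"
  shows "char_poly A = (\<Prod>k\<leftarrow>map a [0..<N]. [:- k, 1:])"
proof -
  let ?U = "mat_of_cols N (map v [0..<N])" and ?D = "mat N N (\<lambda>(i,j). if i = j then a i else 0)"
  note U = orthonormal_basis_mat[OF orthonormal_eigenbasisD(1)[OF v]]
  have D: "?D \<in> carrier_mat N N" by auto
  have col: "col ?U i = v i" if "i < N" for i
    using that orthonormal_eigenbasisD(2)[OF v] by simp
  have AU: "A * ?U = ?U * ?D"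
  proof (rule mat_col_eqI)
    fix j assume "j < dim_col (?U * ?D)"
    then have j: "j < N" by simp
    have "col ?D j = a j \<cdot>\<^sub>v unit_vec N j" using j by (intro eq_vecI) auto
    then have "col (?U * ?D) j = a j \<cdot>\<^sub>v (?U *\<^sub>v unit_vec N j)"
      using j col_mult2[OF U(1) D, of j] U(1) by (simp add: mult_mat_vec)
    also have "?U *\<^sub>v unit_vec N j = col ?U j"
      using j by (intro eq_vecI) auto
    also have "col ?U j = v j" using col[OF j] .
    finally show "col (A * ?U) j = col (?U * ?D) j"
      using j col_mult2[OF A U(1), of j] col orthonormal_eigenbasisD(3)[OF v] by simp
  qed (use A U in auto)
  have UT: "transpose_mat ?U \<in> carrier_mat N N" using U(1) by simp
  have "A = A * (?U * transpose_mat ?U)" using U A by simp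
  also have "\<dots> = ?U * ?D * transpose_mat ?U"
    unfolding AU[symmetric] by (rule assoc_mult_mat[OF A U(1) UT, symmetric])
  finally have eq: "A = ?U * ?D * transpose_mat ?U" .
  have "similar_mat A ?D"
    by (rule similar_matI[OF _ U(3,2) eq]) (simp add: U(1) A)
  then have "char_poly A = char_poly ?D" by (rule char_poly_similar)
  also have "\<dots> = (\<Prod>k\<leftarrow>diag_mat ?D. [:- k, 1:])"
    by (rule char_poly_upper_triangular[OF D]) (auto intro!: upper_triangularI)
  also have "diag_mat ?D = map a [0..<N]"
    by (auto simp: diag_mat_def intro!: nth_equalityI)
  finally show ?thesis .
qed

lemma order_prod_list_linear:
  "Polynomial.order k (\<Prod>a\<leftarrow>ls. [:- a, 1 :: real:]) = count_list ls k"
proof (induction ls)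
  case (Cons b ls)
  have "(\<Prod>a\<leftarrow>ls. [:- a, 1 :: real:]) \<noteq> 0" by (auto simp: prod_list_zero_iff)
  then have "[:- b, 1 :: real:] * (\<Prod>a\<leftarrow>ls. [:- a, 1 :: real:]) \<noteq> 0"
    by (intro no_zero_divisors) simp_all
  then have "Polynomial.order k (\<Prod>a\<leftarrow>b # ls. [:- a, 1 :: real:]) =
    Polynomial.order k [:- b, 1 :: real:] + Polynomial.order k (\<Prod>a\<leftarrow>ls. [:- a, 1 :: real:])"
    using Polynomial.order_mult[of "[:- b, 1 :: real:]" "\<Prod>a\<leftarrow>ls. [:- a, 1 :: real:]" k]
    by (simp only: list.map prod_list.Cons not_False_eq_True)
  moreover have "Polynomial.order k [:- b, 1 :: real:] = (if k = b then 1 else 0)"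
    using order_power_n_n[of b 1] by (auto intro: order_0I)
  ultimately show ?case using Cons by simp
qed (simp add: order_0I)

text \<open>\<open>eigvals_desc\<close> is a definite description, so uniqueness has to be shown:
  the orders of the roots of the product determine the multiset of the list, and the decreasing
  order then fixes the list.\<close>

lemma eigvals_desc_eigenbasis:
  assumes v: "orthonormal_eigenbasis N A v a" and A: "A \<in> carrier_mat N N"
    and desc: "\<And>i j. i \<le> j \<Longrightarrow> j < N \<Longrightarrow> a j \<le> a i"
  shows "eigvals_desc A = map a [0..<N]"
  unfolding eigvals_desc_def
proof (rule the_equality)
  have s: "sorted_wrt (\<ge>) (map a [0..<N])"
    using desc by (auto simp: sorted_wrt_iff_nth_less)
  then show *: "length (map a [0..<N]) = dim_row A \<and> sorted_wrt (\<ge>) (map a [0..<N]) \<and>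
      char_poly A = (\<Prod>k\<leftarrow>map a [0..<N]. [:- k, 1:])"
    using A char_poly_eigenbasis[OF v A] by auto
  fix ls assume ls: "length ls = dim_row A \<and> sorted_wrt (\<ge>) ls \<and> char_poly A = (\<Prod>k\<leftarrow>ls. [:- k, 1:])"
  have "count_list ls k = count_list (map a [0..<N]) k" for k
    using ls * order_prod_list_linear by metis
  then have "mset (rev ls) = mset (rev (map a [0..<N]))"
    by (intro multiset_eqI) (simp only: mset_rev count_mset)
  moreover have "sorted (rev ls)" "sorted (rev (map a [0..<N]))"
    using ls s by (simp_all only: sorted_wrt_rev)
  ultimately have "rev ls = rev (map a [0..<N])" by (metis properties_for_sort)
  then show "ls = map a [0..<N]" by (metis rev_rev_ident)
qed

subsection \<open>Sums of squares of subgaussian variables\<close>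

lemma nn_integral_normal_density:
  "0 < s \<Longrightarrow> (\<integral>\<^sup>+x. ennreal (normal_density b s x) \<partial>lborel) = 1"
  using nn_integral_eq_integral[of lborel "normal_density b s"] by simp

text \<open>Completing the square: the factor \<open>exp (b * x)\<close> moves the Gaussian density
  to mean \<open>b\<close>. With the nonnegative integral, the later exchange of integrals raises no
  integrability question.\<close>

lemma nn_integral_std_normal_exp_linear:
  "(\<integral>\<^sup>+x. ennreal (std_normal_density x * exp (b * x)) \<partial>lborel) = ennreal (exp (b^2 / 2))"
proof -
  have "std_normal_density x * exp (b * x) = exp (b^2 / 2) * normal_density b 1 x" for x
    by (simp add: normal_density_def exp_add[symmetric] field_simps power2_eq_square)
  then have "(\<integral>\<^sup>+x. ennreal (std_normal_density x * exp (b * x)) \<partial>lborel)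
    = (\<integral>\<^sup>+x. ennreal (exp (b^2 / 2)) * ennreal (normal_density b 1 x) \<partial>lborel)"
    by (simp add: ennreal_mult)
  also have "\<dots> = ennreal (exp (b^2 / 2))"
    by (subst nn_integral_cmult) (simp_all add: nn_integral_normal_density)
  finally show ?thesis .
qed

text \<open>The quadratic exponent turns the Gaussian density into a multiple of the one with
  variance \<open>1 / (1 - a)\<close>, hence \<open>a < 1\<close>.\<close>

lemma nn_integral_std_normal_exp_square:
  assumes "a < 1"
  shows "(\<integral>\<^sup>+x. ennreal (std_normal_density x * exp (a * x^2 / 2)) \<partial>lborel) = ennreal (1 / sqrt (1 - a))"
proof -
  define s where "s = 1 / sqrt (1 - a)"
  have s: "0 < s" "s^2 = 1 / (1 - a)" using assms by (auto simp: s_def power_divide)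
  have "std_normal_density x * exp (a * x^2 / 2) = s * normal_density 0 s x" for x
  proof -
    have "a * x^2 / 2 - x^2 / 2 = - (x^2 / (2 * s^2))"
      using assms by (simp add: s(2) field_simps)
    moreover have "s / sqrt (2 * pi * s^2) = 1 / sqrt (2 * pi)"
      using s(1) by (simp add: real_sqrt_mult)
    moreover have "s * normal_density 0 s x = s / sqrt (2 * pi * s^2) * exp (- (x^2 / (2 * s^2)))"
      by (simp add: normal_density_def)
    ultimately show ?thesis
      by (simp add: normal_density_def exp_add[symmetric])
  qed
  then have "(\<integral>\<^sup>+x. ennreal (std_normal_density x * exp (a * x^2 / 2)) \<partial>lborel)
    = (\<integral>\<^sup>+x. ennreal s * ennreal (normal_density 0 s x) \<partial>lborel)"
    using s(1) by (simp add: ennreal_mult)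
  also have "\<dots> = ennreal s"
    using s(1) by (subst nn_integral_cmult) (simp_all add: nn_integral_normal_density)
  finally show ?thesis by (simp add: s_def)
qed

text \<open>The square is linearised by writing \<open>exp (c Z\<^sup>2)\<close> as the moment generating function of an
  independent standard Gaussian evaluated at \<open>sqrt (2 c) Z\<close>.\<close>
lemma (in prob_space) subgaussian_exp_square:
  fixes Z :: "'a \<Rightarrow> real"
  assumes Z[measurable]: "Z \<in> borel_measurable M"
    and int: "\<And>s. integrable M (\<lambda>\<omega>. exp (s * Z \<omega>))"
    and mgf: "\<And>s. (\<integral>\<omega>. exp (s * Z \<omega>) \<partial>M) \<le> exp (s^2 * \<tau> / 2)"
    and c: "0 \<le> c" "2 * c * \<tau> < 1"
  shows "(\<integral>\<^sup>+\<omega>. ennreal (exp (c * (Z \<omega>)^2)) \<partial>M) \<le> ennreal (1 / sqrt (1 - 2 * c * \<tau>))"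
proof -
  interpret PL: pair_sigma_finite M lborel by unfold_locales
  have "(\<integral>\<^sup>+\<omega>. ennreal (exp (c * (Z \<omega>)^2)) \<partial>M)
    = (\<integral>\<^sup>+\<omega>. (\<integral>\<^sup>+g. ennreal (std_normal_density g * exp (sqrt (2 * c) * Z \<omega> * g)) \<partial>lborel) \<partial>M)"
    using c(1) by (subst nn_integral_std_normal_exp_linear) (simp add: power_mult_distrib mult_ac)
  also have "\<dots> = (\<integral>\<^sup>+g. (\<integral>\<^sup>+\<omega>. ennreal (std_normal_density g * exp (sqrt (2 * c) * Z \<omega> * g)) \<partial>M) \<partial>lborel)"
    by (rule PL.Fubini'[symmetric]) simp
  \<comment> \<open>For fixed \<open>g\<close> the moment generating function of \<open>Z\<close> is
    taken at \<open>sqrt (2 * c) * g\<close>, which leaves a Gaussian integral with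
    \<open>a = 2 * c * \<tau>\<close>.\<close>
  also have "\<dots> \<le> (\<integral>\<^sup>+g. ennreal (std_normal_density g * exp ((2 * c * \<tau>) * g^2 / 2)) \<partial>lborel)"
  proof (rule nn_integral_mono)
    fix g :: real
    have "(\<integral>\<^sup>+\<omega>. ennreal (exp ((sqrt (2 * c) * g) * Z \<omega>)) \<partial>M) = ennreal (\<integral>\<omega>. exp ((sqrt (2 * c) * g) * Z \<omega>) \<partial>M)"
      by (rule nn_integral_eq_integral) (use int in auto)
    also have "\<dots> \<le> ennreal (exp ((2 * c * \<tau>) * g^2 / 2))"
      using mgf[of "sqrt (2 * c) * g"] c(1) by (intro ennreal_leI) (simp add: power_mult_distrib mult_ac)
    finally have "(\<integral>\<^sup>+\<omega>. ennreal (exp ((sqrt (2 * c) * g) * Z \<omega>)) \<partial>M) \<le> ennreal (exp ((2 * c * \<tau>) * g^2 / 2))" .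
    then have "ennreal (std_normal_density g) * (\<integral>\<^sup>+\<omega>. ennreal (exp ((sqrt (2 * c) * g) * Z \<omega>)) \<partial>M)
      \<le> ennreal (std_normal_density g) * ennreal (exp ((2 * c * \<tau>) * g^2 / 2))"
      by (rule mult_left_mono) simp
    then show "(\<integral>\<^sup>+\<omega>. ennreal (std_normal_density g * exp (sqrt (2 * c) * Z \<omega> * g)) \<partial>M)
      \<le> ennreal (std_normal_density g * exp ((2 * c * \<tau>) * g^2 / 2))"
      by (simp add: ennreal_mult nn_integral_cmult mult_ac)
  qed
  also have "\<dots> = ennreal (1 / sqrt (1 - 2 * c * \<tau>))"
    using c(2) by (rule nn_integral_std_normal_exp_square)
  finally show ?thesis .
qed

text \<open>Convexity of the exponential, with weights proportional to \<open>\<tau> i\<close>, replaces independence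
  of the \<open>Z i\<close>.\<close>
lemma (in prob_space) subgaussian_sum_squares_tail_pos:
  fixes Z :: "nat \<Rightarrow> 'a \<Rightarrow> real" and K :: nat
  assumes Z[measurable]: "\<And>i. i < K \<Longrightarrow> Z i \<in> borel_measurable M"
    and int: "\<And>i s. i < K \<Longrightarrow> integrable M (\<lambda>\<omega>. exp (s * Z i \<omega>))"
    and mgf: "\<And>i s. i < K \<Longrightarrow> (\<integral>\<omega>. exp (s * Z i \<omega>) \<partial>M) \<le> exp (s^2 * \<tau> i / 2)"
    and pos: "\<And>i. i < K \<Longrightarrow> 0 < \<tau> i" and K: "0 < K" and t: "1 \<le> t"
  shows "1 - exp (- t) \<le> prob {\<omega> \<in> space M. (\<Sum>i<K. (Z i \<omega>)^2) \<le> 5 * t * (\<Sum>i<K. \<tau> i)}"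
proof -
  define S where "S = (\<Sum>i<K. \<tau> i)"
  have S: "0 < S" unfolding S_def using pos K by (intro sum_pos) auto
  define B where "B = {\<omega> \<in> space M. 5 * t * S < (\<Sum>i<K. (Z i \<omega>)^2)}"
  have meas[measurable]: "(\<lambda>\<omega>. \<Sum>i<K. (Z i \<omega>)^2) \<in> borel_measurable M"
    using Z by (intro borel_measurable_sum borel_measurable_power) auto
  have B[measurable]: "B \<in> sets M" unfolding B_def by measurable
  \<comment> \<open>The rate \<open>2 / (5 * S)\<close> makes the exponent the average, with weights
    \<open>\<tau> i / S\<close>, of the terms \<open>2 / (5 * \<tau> i) * (Z i \<omega>)^2\<close>.
    Each of these has \<open>2 * c * \<tau> i = 4/5\<close>, so its exponential moment is at most
    \<open>1 / sqrt (1/5) = sqrt 5\<close>, the same for all \<open>i\<close>.\<close>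
  have convex: "exp (2 / (5 * S) * (\<Sum>i<K. (Z i \<omega>)^2))
      \<le> (\<Sum>i<K. \<tau> i / S * exp (2 / (5 * \<tau> i) * (Z i \<omega>)^2))" for \<omega>
  proof -
    have "2 / (5 * S) * (\<Sum>i<K. (Z i \<omega>)^2) = (\<Sum>i<K. (\<tau> i / S) *\<^sub>R (2 / (5 * \<tau> i) * (Z i \<omega>)^2))"
      unfolding sum_distrib_left using pos S by (intro sum.cong refl) (force simp: field_simps)
    moreover have "exp (\<Sum>i<K. (\<tau> i / S) *\<^sub>R (2 / (5 * \<tau> i) * (Z i \<omega>)^2))
      \<le> (\<Sum>i<K. \<tau> i / S * exp (2 / (5 * \<tau> i) * (Z i \<omega>)^2))"
      using pos S K by (intro convex_on_sum[OF _ _ exp_convex])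
        (auto simp: S_def sum_divide_distrib[symmetric] intro: less_imp_le)
    ultimately show ?thesis by simp
  qed
  have each: "(\<integral>\<^sup>+\<omega>. ennreal (exp (2 / (5 * \<tau> i) * (Z i \<omega>)^2)) \<partial>M) \<le> ennreal (sqrt 5)" if i: "i < K" for i
  proof -
    have "2 * (2 / (5 * \<tau> i)) * \<tau> i = 4 / 5" using pos[OF i] by simp
    then have "(\<integral>\<^sup>+\<omega>. ennreal (exp (2 / (5 * \<tau> i) * (Z i \<omega>)^2)) \<partial>M) \<le> ennreal (1 / sqrt (1 - 4/5))"
      using subgaussian_exp_square[OF Z[OF i] int[OF i] mgf[OF i], of "2 / (5 * \<tau> i)"] pos[OF i] by simp
    also have "1 / sqrt (1 - 4/5) = sqrt (5::real)" by (simp add: real_sqrt_divide)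
    finally show ?thesis .
  qed
  have "(\<integral>\<^sup>+\<omega>. ennreal (exp (2 / (5 * S) * (\<Sum>i<K. (Z i \<omega>)^2))) \<partial>M)
    \<le> (\<integral>\<^sup>+\<omega>. (\<Sum>i<K. ennreal (\<tau> i / S) * ennreal (exp (2 / (5 * \<tau> i) * (Z i \<omega>)^2))) \<partial>M)"
  proof (rule nn_integral_mono)
    fix \<omega>
    have "ennreal (exp (2 / (5 * S) * (\<Sum>i<K. (Z i \<omega>)^2)))
      \<le> ennreal (\<Sum>i<K. \<tau> i / S * exp (2 / (5 * \<tau> i) * (Z i \<omega>)^2))"
      by (rule ennreal_leI[OF convex])
    also have "\<dots> = (\<Sum>i<K. ennreal (\<tau> i / S * exp (2 / (5 * \<tau> i) * (Z i \<omega>)^2)))"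
      using pos S by (intro sum_ennreal[symmetric]) (auto simp: less_imp_le)
    also have "\<dots> = (\<Sum>i<K. ennreal (\<tau> i / S) * ennreal (exp (2 / (5 * \<tau> i) * (Z i \<omega>)^2)))"
      using pos S by (intro sum.cong refl ennreal_mult) (auto simp: less_imp_le)
    finally show "ennreal (exp (2 / (5 * S) * (\<Sum>i<K. (Z i \<omega>)^2))) \<le> \<dots>" .
  qed
  also have "\<dots> = (\<Sum>i<K. ennreal (\<tau> i / S) * (\<integral>\<^sup>+\<omega>. ennreal (exp (2 / (5 * \<tau> i) * (Z i \<omega>)^2)) \<partial>M))"
    using Z by (subst nn_integral_sum) (auto intro!: sum.cong nn_integral_cmult)
  also have "\<dots> \<le> (\<Sum>i<K. ennreal (\<tau> i / S) * ennreal (sqrt 5))"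
    by (intro sum_mono mult_left_mono each) auto
  also have "\<dots> = ennreal (\<Sum>i<K. \<tau> i / S * sqrt 5)"
    using pos S by (subst sum_ennreal[symmetric]) (auto simp: ennreal_mult[symmetric] less_imp_le intro!: sum.cong)
  also have "(\<Sum>i<K. \<tau> i / S * sqrt 5) = sqrt 5"
    using S by (simp add: sum_distrib_right[symmetric] sum_divide_distrib[symmetric] S_def)
  finally have mom: "(\<integral>\<^sup>+\<omega>. ennreal (exp (2 / (5 * S) * (\<Sum>i<K. (Z i \<omega>)^2))) \<partial>M) \<le> ennreal (sqrt 5)" .
  have "emeasure M B \<le> (\<integral>\<^sup>+\<omega>. ennreal (exp (- (2 * t))) * ennreal (exp (2 / (5 * S) * (\<Sum>i<K. (Z i \<omega>)^2))) \<partial>M)"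
  proof -
    have "emeasure M B = (\<integral>\<^sup>+\<omega>. indicator B \<omega> \<partial>M)" by simp
    also have "\<dots> \<le> (\<integral>\<^sup>+\<omega>. ennreal (exp (- (2 * t))) * ennreal (exp (2 / (5 * S) * (\<Sum>i<K. (Z i \<omega>)^2))) \<partial>M)"
    proof (rule nn_integral_mono)
      fix \<omega>
      show "indicator B \<omega> \<le> ennreal (exp (- (2 * t))) * ennreal (exp (2 / (5 * S) * (\<Sum>i<K. (Z i \<omega>)^2)))"
      proof (cases "\<omega> \<in> B")
        case True
        then have "2 * t \<le> 2 / (5 * S) * (\<Sum>i<K. (Z i \<omega>)^2)"
          using S by (simp add: B_def field_simps)
        then have "1 \<le> exp (- (2 * t) + 2 / (5 * S) * (\<Sum>i<K. (Z i \<omega>)^2))" by simp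
        then have "ennreal 1 \<le> ennreal (exp (- (2 * t)) * exp (2 / (5 * S) * (\<Sum>i<K. (Z i \<omega>)^2)))"
          unfolding exp_add by (rule ennreal_leI)
        then show ?thesis using True by (simp add: ennreal_mult)
      qed simp
    qed
    finally show ?thesis .
  qed
  also have "\<dots> = ennreal (exp (- (2 * t))) * (\<integral>\<^sup>+\<omega>. ennreal (exp (2 / (5 * S) * (\<Sum>i<K. (Z i \<omega>)^2))) \<partial>M)"
    by (rule nn_integral_cmult) measurable
  also have "\<dots> \<le> ennreal (exp (- (2 * t))) * ennreal (sqrt 5)"
    by (rule mult_left_mono[OF mom]) simp
  also have "\<dots> = ennreal (exp (- (2 * t)) * sqrt 5)" by (simp add: ennreal_mult)
  also have "\<dots> \<le> ennreal (exp (- t))"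
  proof (rule ennreal_leI)
    \<comment> \<open>On \<open>B\<close> the exponent exceeds \<open>2 * t\<close>, and Markov's
      inequality leaves \<open>exp (- (2 * t)) * sqrt 5\<close>. As
      \<open>sqrt 5 \<le> 5/2 \<le> exp 1\<close>, half of the decay pays for the prefactor; this is
      where \<open>1 \<le> t\<close> enters.\<close>
    have "sqrt 5 \<le> 1 + 1 + (1::real)^2 / 2" by (intro real_le_lsqrt) (auto simp: power2_eq_square)
    also have "\<dots> \<le> exp 1" by (rule exp_lower_Taylor_quadratic) simp
    also have "\<dots> \<le> exp t" using t by simp
    finally have "sqrt 5 \<le> exp t" .
    then have "exp (- (2 * t)) * sqrt 5 \<le> exp (- (2 * t)) * exp t" by simp
    also have "\<dots> = exp (- t)" by (simp flip: exp_add)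
    finally show "exp (- (2 * t)) * sqrt 5 \<le> exp (- t)" .
  qed
  finally have "prob B \<le> exp (- t)" by (simp add: emeasure_eq_measure)
  moreover have "{\<omega> \<in> space M. (\<Sum>i<K. (Z i \<omega>)^2) \<le> 5 * t * (\<Sum>i<K. \<tau> i)} = space M - B"
    by (auto simp: B_def S_def)
  ultimately show ?thesis using prob_compl[OF B] by simp
qed

text \<open>The convexity argument divides by \<open>\<tau> i\<close>, so vanishing proxies are
  reached as a limit: each proxy is raised by \<open>1 / real (Suc j)\<close>, and the resulting
  events decrease to the wanted one, along which the measure is continuous.\<close>

lemma (in prob_space) subgaussian_sum_squares_tail:
  fixes Z :: "nat \<Rightarrow> 'a \<Rightarrow> real" and K :: nat
  assumes Z: "\<And>i. i < K \<Longrightarrow> Z i \<in> borel_measurable M"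
    and int: "\<And>i s. i < K \<Longrightarrow> integrable M (\<lambda>\<omega>. exp (s * Z i \<omega>))"
    and mgf: "\<And>i s. i < K \<Longrightarrow> (\<integral>\<omega>. exp (s * Z i \<omega>) \<partial>M) \<le> exp (s^2 * \<tau> i / 2)"
    and nonneg: "\<And>i. i < K \<Longrightarrow> 0 \<le> \<tau> i" and t: "1 \<le> t"
  shows "1 - exp (- t) \<le> prob {\<omega> \<in> space M. (\<Sum>i<K. (Z i \<omega>)^2) \<le> 5 * t * (\<Sum>i<K. \<tau> i)}"
proof (cases "K = 0")
  case True
  then show ?thesis using prob_space by simp
next
  case False
  define A where "A j = {\<omega> \<in> space M. (\<Sum>i<K. (Z i \<omega>)^2) \<le> 5 * t * (\<Sum>i<K. \<tau> i + 1 / real (Suc j))}" for j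
  have [measurable]: "(\<lambda>\<omega>. \<Sum>i<K. (Z i \<omega>)^2) \<in> borel_measurable M"
    using Z by (intro borel_measurable_sum borel_measurable_power) auto
  have "1 - exp (- t) \<le> prob (A j)" for j
    unfolding A_def
  proof (rule subgaussian_sum_squares_tail_pos[OF Z int _ _ _ t])
    fix i s assume i: "i < K"
    show "0 < \<tau> i + 1 / real (Suc j)" using nonneg[OF i] by (simp add: add_nonneg_pos)
    have "s^2 * \<tau> i / 2 \<le> s^2 * (\<tau> i + 1 / real (Suc j)) / 2"
      by (intro divide_right_mono mult_left_mono) auto
    then show "(\<integral>\<omega>. exp (s * Z i \<omega>) \<partial>M) \<le> exp (s^2 * (\<tau> i + 1 / real (Suc j)) / 2)"
      using mgf[OF i, of s] by (meson exp_le_cancel_iff order_trans)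
  qed (use False in auto)
  then have "\<exists>k. \<forall>j\<ge>k. 1 - exp (- t) \<le> prob (A j)" by blast
  moreover have "range A \<subseteq> sets M" by (auto simp: A_def)
  moreover have "decseq A"
  proof (rule decseq_SucI)
    fix j
    have "5 * t * (\<Sum>i<K. \<tau> i + 1 / real (Suc (Suc j))) \<le> 5 * t * (\<Sum>i<K. \<tau> i + 1 / real (Suc j))"
      using t by (intro mult_left_mono sum_mono add_left_mono frac_le) auto
    then show "A (Suc j) \<subseteq> A j" unfolding A_def by force
  qed
  moreover have "(\<Inter>j. A j) = {\<omega> \<in> space M. (\<Sum>i<K. (Z i \<omega>)^2) \<le> 5 * t * (\<Sum>i<K. \<tau> i)}"
  proof (intro Set.set_eqI iffI)
    fix \<omega> assume \<omega>: "\<omega> \<in> (\<Inter>j. A j)"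
    have "(\<lambda>j. 5 * t * (\<Sum>i<K. \<tau> i + 1 / real (Suc j))) \<longlonglongrightarrow> 5 * t * (\<Sum>i<K. \<tau> i + 0)"
      by (intro tendsto_intros LIMSEQ_Suc[OF lim_1_over_n])
    then have "(\<Sum>i<K. (Z i \<omega>)^2) \<le> 5 * t * (\<Sum>i<K. \<tau> i + 0)"
      using \<omega> by (intro LIMSEQ_le_const) (auto simp: A_def)
    then show "\<omega> \<in> {\<omega> \<in> space M. (\<Sum>i<K. (Z i \<omega>)^2) \<le> 5 * t * (\<Sum>i<K. \<tau> i)}"
      using \<omega> by (simp add: A_def)
  next
    fix \<omega> assume \<omega>: "\<omega> \<in> {\<omega> \<in> space M. (\<Sum>i<K. (Z i \<omega>)^2) \<le> 5 * t * (\<Sum>i<K. \<tau> i)}"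
    have "5 * t * (\<Sum>i<K. \<tau> i) \<le> 5 * t * (\<Sum>i<K. \<tau> i + 1 / real (Suc j))" for j
      using t by (intro mult_left_mono sum_mono) auto
    then show "\<omega> \<in> (\<Inter>j. A j)" using \<omega> by (auto simp: A_def intro: order_trans)
  qed
  ultimately show ?thesis
    using LIMSEQ_le_const[OF finite_Lim_measure_decseq[of A], of "1 - exp (- t)"] by simp
qed

subsection \<open>Spectral norm\<close>

lemma vnorm_nonneg: "0 \<le> vnorm v"
  by (simp add: vnorm_def sum_nonneg)

lemma gram_mat:
  fixes A :: "real mat"
  assumes A: "A \<in> carrier_mat m N"
  shows "transpose_mat A * A \<in> carrier_mat N N" "transpose_mat (transpose_mat A * A) = transpose_mat A * A"
    "z \<in> carrier_vec N \<Longrightarrow> z \<bullet> ((transpose_mat A * A) *\<^sub>v z) = (A *\<^sub>v z) \<bullet> (A *\<^sub>v z)"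
proof -
  have AT: "transpose_mat A \<in> carrier_mat N m" using A by simp
  show "transpose_mat A * A \<in> carrier_mat N N" using A by simp
  show "transpose_mat (transpose_mat A * A) = transpose_mat A * A"
    using transpose_mult[OF AT A] by simp
  assume z: "z \<in> carrier_vec N"
  show "z \<bullet> ((transpose_mat A * A) *\<^sub>v z) = (A *\<^sub>v z) \<bullet> (A *\<^sub>v z)"
    using scalar_prod_mult_mat_vec_swap[OF AT _ z, of "A *\<^sub>v z"] A z
    by (simp add: assoc_mult_mat_vec[OF AT A z])
qed

text \<open>\<open>spec_norm\<close> is a real supremum and informative only for a bounded set; the
  bound is the square root of the largest eigenvalue of the Gram matrix. The rest is normalisation
  of \<open>z\<close>, with the zero vector treated apart.\<close>

lemma vnorm_mult_le_spec_norm: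
  assumes A: "A \<in> carrier_mat m N" and z: "z \<in> carrier_vec N"
  shows "vnorm (A *\<^sub>v z) \<le> spec_norm A * vnorm z"
proof (cases "z = 0\<^sub>v N")
  case True
  have "A *\<^sub>v 0\<^sub>v N = 0\<^sub>v m" using A by auto
  then show ?thesis using True by (simp add: vnorm_def)
next
  case False
  then have pos: "0 < vnorm z"
    using scalar_prod_self_eq_0[OF z] vnorm_nonneg[of z] vnorm_sq[of z]
    by (cases "vnorm z = 0") auto
  let ?S = "{vnorm (A *\<^sub>v v) | v. v \<in> carrier_vec (dim_col A) \<and> vnorm v = 1}"
  let ?w = "(1 / vnorm z) \<cdot>\<^sub>v z"
  have scale: "vnorm (c \<cdot>\<^sub>v v) = c * vnorm v" if "0 \<le> c" for c v
    using that by (simp add: vnorm_def power_mult_distrib sum_distrib_left[symmetric] real_sqrt_mult)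
  have bdd: "bdd_above ?S"
  proof (rule bdd_aboveI)
    fix s assume "s \<in> ?S"
    then obtain v where v: "s = vnorm (A *\<^sub>v v)" "v \<in> carrier_vec N" "vnorm v = 1" using A by auto
    have "s^2 \<le> lambda_max (transpose_mat A * A)"
      using quadratic_form_le_lambda_max[OF gram_mat(1,2)[OF A] v(2)] gram_mat(3)[OF A v(2)] v
      by (simp add: vnorm_sq[symmetric])
    then show "s \<le> sqrt (lambda_max (transpose_mat A * A))" by (rule real_le_rsqrt)
  qed
  have "vnorm (A *\<^sub>v ?w) \<le> spec_norm A"
    unfolding spec_norm_def
    by (rule cSup_upper[OF _ bdd]) (use A z pos in \<open>auto simp: scale intro!: exI[of _ ?w]\<close>)
  moreover have "A *\<^sub>v ?w = (1 / vnorm z) \<cdot>\<^sub>v (A *\<^sub>v z)"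
    using A z by (simp add: mult_mat_vec)
  ultimately show ?thesis using pos by (simp add: scale field_simps)
qed

lemma mult_mat_vec_sq_le_spec_norm:
  assumes "A \<in> carrier_mat m N" "z \<in> carrier_vec N"
  shows "(A *\<^sub>v z) \<bullet> (A *\<^sub>v z) \<le> (spec_norm A)^2 * (z \<bullet> z)"
  using power_mono[OF vnorm_mult_le_spec_norm[OF assms] vnorm_nonneg, of 2]
  by (simp add: vnorm_sq power_mult_distrib)

lemma scalar_prod_eq_sum:
  "v \<in> carrier_vec N \<Longrightarrow> w \<bullet> v = (\<Sum>i<N. w $ i * v $ i)"
  by (auto simp: scalar_prod_def atLeast0LessThan)

lemma Cauchy_Schwarz_scalar_prod:
  fixes v w :: "real vec"
  assumes "v \<in> carrier_vec N" "w \<in> carrier_vec N"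
  shows "(v \<bullet> w)^2 \<le> (v \<bullet> v) * (w \<bullet> w)"
  using Cauchy_Schwarz_ineq_sum[of "\<lambda>i. v $ i" "\<lambda>i. w $ i" "{..<N}"] assms
  by (simp add: scalar_prod_eq_sum power2_eq_square)

subsection \<open>Slices of a stacked vector\<close>

lemma sum_blocks:
  fixes f :: "nat \<Rightarrow> 'b :: comm_monoid_add"
  shows "(\<Sum>r<n * T. f r) = (\<Sum>k<n. \<Sum>t<T. f (t * n + k))"
proof -
  have "(\<Sum>r<n * T. f r) = (\<Sum>t<T. sum f {t * n..<t * n + n})"
    by (simp add: sum.nat_group mult.commute)
  also have "\<dots> = (\<Sum>t<T. \<Sum>k<n. f (t * n + k))"
  proof (rule sum.cong[OF refl])
    fix t show "sum f {t * n..<t * n + n} = (\<Sum>k<n. f (t * n + k))"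
      using sum.shift_bounds_nat_ivl[of f 0 "t * n" n] by (simp add: atLeast0LessThan add.commute)
  qed
  finally show ?thesis by (simp add: sum.swap[of _ "{..<n}"])
qed

lemma block_index_less:
  fixes t T k n :: nat
  assumes "t < T" "k < n"
  shows "t * n + k < n * T"
proof -
  have "t * n + k < Suc t * n" using assms(2) by simp
  also have "\<dots> \<le> T * n" using assms(1) by (intro mult_le_mono1) simp
  finally show ?thesis by (simp add: mult.commute)
qed

text \<open>One component across all vertices, rather than all components at one vertex: in this
  splitting \<open>kron D (1\<^sub>m n)\<close> acts as \<open>n\<close> separate copies of
  \<open>D\<close>.\<close>

definition slice :: "nat \<Rightarrow> nat \<Rightarrow> nat \<Rightarrow> real vec \<Rightarrow> real vec" where
  "slice T n k z = vec T (\<lambda>t. z $ (t * n + k))"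

lemma slice_carrier [simp]: "slice T n k z \<in> carrier_vec T" "dim_vec (slice T n k z) = T"
  by (auto simp: slice_def)

lemma scalar_prod_slices:
  assumes "w \<in> carrier_vec (n * T)"
  shows "z \<bullet> w = (\<Sum>k<n. slice T n k z \<bullet> slice T n k w)"
  using assms by (simp add: scalar_prod_eq_sum[of _ "n * T"] sum_blocks scalar_prod_eq_sum[of _ T] slice_def)

lemma kron_one_carrier:
  "D \<in> carrier_mat E T \<Longrightarrow> kron D (1\<^sub>m n) \<in> carrier_mat (n * E) (n * T)"
  by (auto simp: kron_def mult.commute)

lemma slice_kron_one:
  assumes D: "D \<in> carrier_mat E T" and z: "z \<in> carrier_vec (n * T)" and k: "k < n"
  shows "slice E n k (kron D (1\<^sub>m n) *\<^sub>v z) = D *\<^sub>v slice T n k z"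
proof (rule eq_vecI)
  fix e assume "e < dim_vec (D *\<^sub>v slice T n k z)"
  then have e: "e < E" using D by simp
  have r: "e * n + k < n * E" by (rule block_index_less[OF e k])
  have "slice E n k (kron D (1\<^sub>m n) *\<^sub>v z) $ e = (\<Sum>c<n * T. kron D (1\<^sub>m n) $$ (e * n + k, c) * z $ c)"
    using e r kron_one_carrier[OF D, of n] z
    by (auto simp: slice_def scalar_prod_eq_sum[OF z] intro!: sum.cong)
  also have "\<dots> = (\<Sum>k'<n. \<Sum>t<T. kron D (1\<^sub>m n) $$ (e * n + k, t * n + k') * z $ (t * n + k'))"
    by (rule sum_blocks)
  also have "\<dots> = (\<Sum>k'<n. if k' = k then \<Sum>t<T. D $$ (e, t) * z $ (t * n + k) else 0)"
  proof (intro sum.cong refl)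
    fix k' assume k': "k' \<in> {..<n}"
    have "kron D (1\<^sub>m n) $$ (e * n + k, t * n + k') = (if k' = k then D $$ (e, t) else 0)" if "t < T" for t
      using D k k' r block_index_less[OF that, of k' n] by (simp add: kron_def mult.commute)
    then show "(\<Sum>t<T. kron D (1\<^sub>m n) $$ (e * n + k, t * n + k') * z $ (t * n + k'))
      = (if k' = k then \<Sum>t<T. D $$ (e, t) * z $ (t * n + k) else 0)"
      by simp
  qed
  also have "\<dots> = (D *\<^sub>v slice T n k z) $ e"
    using e k D by (simp add: scalar_prod_eq_sum[of _ T] slice_def)
  finally show "slice E n k (kron D (1\<^sub>m n) *\<^sub>v z) $ e = (D *\<^sub>v slice T n k z) $ e" .
qed (use D in simp)

lemma kron_one_sq:
  assumes D: "D \<in> carrier_mat E T" and z: "z \<in> carrier_vec (n * T)"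
  shows "(kron D (1\<^sub>m n) *\<^sub>v z) \<bullet> (kron D (1\<^sub>m n) *\<^sub>v z)
    = (\<Sum>k<n. (D *\<^sub>v slice T n k z) \<bullet> (D *\<^sub>v slice T n k z))"
proof -
  have "kron D (1\<^sub>m n) *\<^sub>v z \<in> carrier_vec (n * E)" using kron_one_carrier[OF D, of n] z by simp
  then show ?thesis by (simp add: scalar_prod_slices slice_kron_one[OF D z])
qed

text \<open>For \<open>k < n\<close> this is the isometric adjoint of \<open>slice\<close>. It
  carries eigenvectors of the Laplacian to eigenvectors of the Gram matrix of
  \<open>kron D (1\<^sub>m n)\<close>.\<close>

definition embed_slice :: "nat \<Rightarrow> nat \<Rightarrow> nat \<Rightarrow> real vec \<Rightarrow> real vec" where
  "embed_slice T n k u = vec (n * T) (\<lambda>r. if r mod n = k then u $ (r div n) else 0)"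

lemma embed_slice_carrier [simp]: "embed_slice T n k u \<in> carrier_vec (n * T)"
  by (simp add: embed_slice_def)

lemma embed_slice_scalar_prod:
  assumes z: "z \<in> carrier_vec (n * T)" and k: "k < n"
  shows "embed_slice T n k u \<bullet> z = u \<bullet> slice T n k z"
proof -
  have "embed_slice T n k u \<bullet> z = (\<Sum>k'<n. \<Sum>t<T. if k' = k then u $ t * z $ (t * n + k) else 0)"
    unfolding scalar_prod_eq_sum[OF z] sum_blocks
    by (intro sum.cong refl) (auto simp: embed_slice_def block_index_less)
  also have "\<dots> = (\<Sum>k'<n. if k' = k then \<Sum>t<T. u $ t * z $ (t * n + k) else 0)"
    by (intro sum.cong refl) simp
  also have "\<dots> = u \<bullet> slice T n k z"
    using k by (simp add: scalar_prod_eq_sum[of _ T] slice_def)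
  finally show ?thesis .
qed

lemma embed_slice_sq:
  assumes "u \<in> carrier_vec T" "k < n"
  shows "embed_slice T n k u \<bullet> embed_slice T n k u = u \<bullet> u"
proof -
  have "slice T n k (embed_slice T n k u) = u"
    using assms by (intro eq_vecI) (auto simp: slice_def embed_slice_def block_index_less)
  then show ?thesis using assms by (simp add: embed_slice_scalar_prod)
qed

text \<open>The signals that are constant over the vertices.\<close>

definition replicate_vec :: "nat \<Rightarrow> nat \<Rightarrow> real vec \<Rightarrow> real vec" where
  "replicate_vec T n u = vec (n * T) (\<lambda>r. u $ (r mod n))"

lemma blockdiag_replicate_vec:
  assumes T: "0 < T" and Cs: "\<forall>t<T. Cs t \<in> carrier_mat (m t) n" and u: "u \<in> carrier_vec n"
  shows "blockdiag T n m Cs *\<^sub>v replicate_vec T n u = vstack T n m Cs *\<^sub>v u"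
proof (rule eq_vecI)
  fix r assume "r < dim_vec (vstack T n m Cs *\<^sub>v u)"
  then have r: "r < offs m T" by (simp add: vstack_def)
  \<comment> \<open>The \<open>LEAST\<close> in \<open>vstack\<close> finds the one block whose row
    range contains \<open>r\<close>, which is the test that \<open>blockdiag\<close> performs. The
    strict inequality skips blocks without rows.\<close>
  define s where "s = (LEAST t. r < offs m (Suc t))"
  have mono: "offs m a \<le> offs m b" if "a \<le> b" for a b
    unfolding offs_def using that by (intro sum_mono2) auto
  have ex: "r < offs m (Suc (T - 1))" using r T by simp
  have s1: "r < offs m (Suc s)" unfolding s_def by (rule LeastI[of "\<lambda>t. r < offs m (Suc t)", OF ex])
  have sT: "s < T" using Least_le[of "\<lambda>t. r < offs m (Suc t)", OF ex] T by (simp add: s_def)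
  have s2: "offs m s \<le> r"
  proof (cases s)
    case 0
    then show ?thesis by (simp add: offs_def)
  next
    case (Suc s')
    then show ?thesis using not_less_Least[of s' "\<lambda>t. r < offs m (Suc t)"] by (simp add: s_def)
  qed
  have uniq: "offs m t \<le> r \<and> r < offs m (Suc t) \<longleftrightarrow> t = s" for t
  proof
    assume t: "offs m t \<le> r \<and> r < offs m (Suc t)"
    then have "s \<le> t" unfolding s_def by (intro Least_le) simp
    moreover have "\<not> s < t" using mono[of "Suc s" t] s1 t by auto
    ultimately show "t = s" by simp
  qed (use s1 s2 in simp)
  have "(blockdiag T n m Cs *\<^sub>v replicate_vec T n u) $ r
    = (\<Sum>c<n * T. blockdiag T n m Cs $$ (r, c) * u $ (c mod n))"
    using r by (auto simp: blockdiag_def replicate_vec_def scalar_prod_def atLeast0LessThan intro!: sum.cong)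
  also have "\<dots> = (\<Sum>k<n. \<Sum>t<T. if t = s then Cs s $$ (r - offs m s, k) * u $ k else 0)"
    unfolding sum_blocks
    using r by (intro sum.cong refl) (auto simp: blockdiag_def block_index_less uniq)
  also have "\<dots> = (\<Sum>k<n. Cs s $$ (r - offs m s, k) * u $ k)"
    using sT by simp
  also have "\<dots> = (vstack T n m Cs *\<^sub>v u) $ r"
    using r u by (auto simp: vstack_def scalar_prod_eq_sum[OF u] s_def[symmetric] intro!: sum.cong)
  finally show "(blockdiag T n m Cs *\<^sub>v replicate_vec T n u) $ r = (vstack T n m Cs *\<^sub>v u) $ r" .
qed (simp add: blockdiag_def vstack_def)

subsection \<open>The Laplacian\<close>

lemma incidence_mat_ones:
  assumes "oriented_simple_graph T es"
  shows "incidence_mat T es *\<^sub>v vec T (\<lambda>_. 1) = 0\<^sub>v (length es)"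
proof (rule eq_vecI)
  fix e assume "e < dim_vec (0\<^sub>v (length es) :: real vec)"
  then have e: "e < length es" by simp
  then have "es ! e \<in> set es" by simp
  then have ab: "fst (es ! e) < T" "snd (es ! e) < T" "fst (es ! e) \<noteq> snd (es ! e)"
    using assms by (cases "es ! e"; force simp: oriented_simple_graph_def)+
  have "(incidence_mat T es *\<^sub>v vec T (\<lambda>_. 1)) $ e
    = (\<Sum>t<T. (if t = fst (es ! e) then 1 else 0) - (if t = snd (es ! e) then 1 else 0))"
    using e ab(3) by (auto simp: incidence_mat_def scalar_prod_def atLeast0LessThan intro!: sum.cong)
  also have "\<dots> = 0" using ab(1,2) by (simp add: sum_subtractf)
  finally show "(incidence_mat T es *\<^sub>v vec T (\<lambda>_. 1)) $ e = 0\<^sub>v (length es) $ e" using e by simp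
qed (simp add: incidence_mat_def)

text \<open>Counting from 0, \<open>a (T - 2)\<close> is the second smallest eigenvalue.
  Eigenvectors with positive eigenvalue are orthogonal to the all-ones vector, which
  \<open>D\<close> annihilates; so the last eigenvector is parallel to it, and the subtracted square
  is the squared coefficient of \<open>z\<close> along that eigenvector.\<close>

lemma laplacian_gap:
  fixes D :: "real mat"
  assumes D: "D \<in> carrier_mat E T" and T: "2 \<le> T" and ones: "D *\<^sub>v vec T (\<lambda>_. 1) = 0\<^sub>v E"
    and u: "orthonormal_eigenbasis T (transpose_mat D * D) u a"
    and desc: "\<And>i j. i \<le> j \<Longrightarrow> j < T \<Longrightarrow> a j \<le> a i"
    and b: "0 < b" "b \<le> a (T - 2)"
  shows "a (T - 1) = 0"
    and "z \<in> carrier_vec T \<Longrightarrow>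
      b * (z \<bullet> z - (vec T (\<lambda>_. 1) \<bullet> z)^2 / T) \<le> (D *\<^sub>v z) \<bullet> (D *\<^sub>v z)"
proof -
  let ?L = "transpose_mat D * D" and ?e = "vec T (\<lambda>_. 1) :: real vec" and ?l = "T - 1"
  note L = gram_mat(1,2)[OF D]
  have on: "orthonormal_basis T u" by (rule orthonormal_eigenbasisD(1)[OF u])
  have e: "?e \<in> carrier_vec T" by simp
  have l: "?l < T" using T by simp
  have split: "{..<T} = insert ?l {..<?l}" using T by auto
  have "?L *\<^sub>v ?e = 0\<^sub>v T"
    using D by (subst assoc_mult_mat_vec[of _ T E _ T]) (auto simp: ones)
  then have "a i * (u i \<bullet> ?e) = 0" if "i < T" for i
    using eigenbasis_coeff[OF u L e that] orthonormal_basisD(1)[OF on that] by simp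
  moreover have large: "b \<le> a i" if "i < ?l" for i
    using desc[of i "T - 2"] that b(2) by force
  ultimately have zero: "u i \<bullet> ?e = 0" if "i < ?l" for i
    using that b(1) l by (metis less_le_trans less_irrefl mult_eq_0_iff order.strict_trans)
  have e_z: "?e \<bullet> w = (u ?l \<bullet> ?e) * (u ?l \<bullet> w)" if "w \<in> carrier_vec T" for w
    unfolding parseval[OF on e that] split by (simp add: zero)
  have "?e \<bullet> ?e = real T" by (simp add: scalar_prod_def)
  then have norm: "(u ?l \<bullet> ?e)^2 = real T" using e_z[OF e] by (simp add: power2_eq_square)
  then have "u ?l \<bullet> ?e \<noteq> 0" using T by auto
  then show al: "a ?l = 0"
    using \<open>\<And>i. i < T \<Longrightarrow> a i * (u i \<bullet> ?e) = 0\<close>[OF l] by simp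
  assume z: "z \<in> carrier_vec T"
  have "(?e \<bullet> z)^2 / T = (u ?l \<bullet> z)^2"
    using norm T by (simp add: e_z[OF z] power_mult_distrib)
  then have "z \<bullet> z - (?e \<bullet> z)^2 / T = (\<Sum>i<?l. (u i \<bullet> z)^2)"
    unfolding parseval_self[OF on z] split by simp
  then have "b * (z \<bullet> z - (?e \<bullet> z)^2 / T) = (\<Sum>i<?l. b * (u i \<bullet> z)^2)"
    by (simp add: sum_distrib_left)
  also have "\<dots> \<le> (\<Sum>i<?l. a i * (u i \<bullet> z)^2)"
    using large by (intro sum_mono mult_right_mono) auto
  also have "\<dots> = z \<bullet> (?L *\<^sub>v z)"
    unfolding eigenbasis_quadratic_form[OF u L z] split using al by simp
  also have "\<dots> = (D *\<^sub>v z) \<bullet> (D *\<^sub>v z)" by (rule gram_mat(3)[OF D z])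
  finally show "b * (z \<bullet> z - (?e \<bullet> z)^2 / T) \<le> (D *\<^sub>v z) \<bullet> (D *\<^sub>v z)" .
qed

subsection \<open>The smallest eigenvalue of the regularized matrix\<close>

lemma lam_bar'_quadratic_le:
  fixes b1 b2 b3 \<mu> \<alpha> \<beta> :: real
  assumes "0 < \<mu> * b1" "0 < b2" "0 < b3" "0 \<le> \<alpha>" "0 \<le> \<beta>"
  shows "lam_bar' b1 b2 b3 \<mu> * (\<alpha>^2 + \<beta>^2) \<le> \<mu> * b1 * \<beta>^2 + max 0 (b2 * \<alpha>^2 - b3 * \<alpha> * \<beta>)"
    and "0 < lam_bar' b1 b2 b3 \<mu>"
    and "b2 + b3^2 / b2 \<le> \<mu> * b1 \<Longrightarrow> b2 / 4 \<le> lam_bar' b1 b2 b3 \<mu>"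
proof -
  define q where "q = \<mu> * b1"
  define s where "s = b2^2 + b3^2"
  define R where "R = sqrt (b3^2 + (q - b2)^2)"
  have q: "0 < q" and s: "0 < s" using assms by (auto simp: q_def s_def add_pos_pos)
  have thr: "b2 + (b3^2 - b2^2) / (2 * b2) = s / (2 * b2)"
    using assms by (simp add: s_def field_simps power2_eq_square)
  have R: "0 < R" "R^2 = b3^2 + (q - b2)^2"
    using assms by (auto simp: R_def add_pos_nonneg)
  have lam1: "lam_bar' b1 b2 b3 \<mu> = b2^2 * q / (2 * s)" if "q < s / (2 * b2)"
    using that by (simp add: lam_bar'_def thr flip: q_def) (simp add: s_def q_def)
  \<comment> \<open>The form has the symmetric 2x2 matrix with diagonal \<open>b2\<close>,
    \<open>q\<close> and off-diagonal entry \<open>- b3 / 2\<close>. Its eigenvalues are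
    \<open>(q + b2 + R) / 2\<close> and \<open>(q + b2 - R) / 2\<close>, and the branch is half of
    the smaller one.\<close>
  have lam2: "lam_bar' b1 b2 b3 \<mu> = (q + b2 - R) / 4" if "\<not> q < s / (2 * b2)"
  proof -
    have "lam_bar' b1 b2 b3 \<mu> = 1/4 * (1 - (q - b2) / R) * q + b2 / 4 + (b2 * (q - b2) - b3^2) / (4 * R)"
      using that by (simp add: lam_bar'_def thr mult.assoc flip: q_def R_def)
    also have "\<dots> = ((R - (q - b2)) * q + b2 * R + (b2 * (q - b2) - b3^2)) / (4 * R)"
      using R(1) by (simp add: field_simps)
    also have "\<dots> = (R * (q + b2) - R^2) / (4 * R)"
      unfolding R(2) by (simp add: power2_eq_square algebra_simps)
    also have "\<dots> = (q + b2 - R) / 4" using R(1) by (simp add: field_simps power2_eq_square)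
    finally show ?thesis .
  qed
  \<comment> \<open>Lying above the threshold means \<open>R \<le> q\<close>, and then the closed
    form keeps at least \<open>b2 / 4\<close>.\<close>
  have big: "b2 \<le> 4 * lam_bar' b1 b2 b3 \<mu>" if c: "\<not> q < s / (2 * b2)"
  proof -
    have "s \<le> 2 * b2 * q" using c assms by (simp add: field_simps)
    then have "R^2 \<le> q^2" unfolding R(2) s_def by (simp add: power2_eq_square algebra_simps)
    then have "R \<le> q" using q by (rule power2_le_imp_le[OF _ less_imp_le])
    then show ?thesis using lam2[OF c] by simp
  qed
  show "0 < lam_bar' b1 b2 b3 \<mu>"
  proof (cases "q < s / (2 * b2)")
    case True
    then show ?thesis using q s assms by (simp add: lam1)
  next
    case False
    then show ?thesis using big assms(2) by simp
  qed
  show "b2 / 4 \<le> lam_bar' b1 b2 b3 \<mu>" if "b2 + b3^2 / b2 \<le> \<mu> * b1"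
  proof -
    have "s / (2 * b2) \<le> b2 + b3^2 / b2"
      using assms(2) unfolding s_def by (simp add: field_simps power2_eq_square)
    then have "\<not> q < s / (2 * b2)" using that unfolding q_def by simp
    then show ?thesis using big by simp
  qed
  show "lam_bar' b1 b2 b3 \<mu> * (\<alpha>^2 + \<beta>^2) \<le> \<mu> * b1 * \<beta>^2 + max 0 (b2 * \<alpha>^2 - b3 * \<alpha> * \<beta>)"
    unfolding q_def[symmetric]
  proof (cases "q < s / (2 * b2)")
    case True
    show "lam_bar' b1 b2 b3 \<mu> * (\<alpha>^2 + \<beta>^2) \<le> q * \<beta>^2 + max 0 (b2 * \<alpha>^2 - b3 * \<alpha> * \<beta>)"
    proof (cases "b2 * \<alpha> \<le> b3 * \<beta>")
      \<comment> \<open>On this side of the line \<open>b2 * \<alpha> = b3 * \<beta>\<close> the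
        penalty alone suffices: the share of \<open>\<beta>^2\<close> in
        \<open>\<alpha>^2 + \<beta>^2\<close> is at least its value \<open>b2^2 / s\<close> on the
        line.\<close>
      case le: True
      have "(b2 * \<alpha>)^2 \<le> (b3 * \<beta>)^2" using le assms by (intro power_mono) auto
      then have "b2^2 * (\<alpha>^2 + \<beta>^2) \<le> s * \<beta>^2" by (simp add: s_def power_mult_distrib algebra_simps)
      then have "q / (2 * s) * (b2^2 * (\<alpha>^2 + \<beta>^2)) \<le> q / (2 * s) * (s * \<beta>^2)"
        using q s by (intro mult_left_mono) auto
      also have "\<dots> = q * \<beta>^2 / 2" using s by simp
      also have "\<dots> \<le> q * \<beta>^2" using q by simp
      finally show ?thesis by (simp add: lam1[OF True] mult_ac)
    next
      case False
      \<comment> \<open>The excess over the line. The observation term equals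
        \<open>\<alpha> * \<gamma>\<close>, and it absorbs what the left side gains with \<gamma>,
        because below the threshold \<open>q / (2 * s)\<close> is at most
        \<open>1 / (4 * b2)\<close>.\<close>
      define \<gamma> where "\<gamma> = b2 * \<alpha> - b3 * \<beta>"
      have \<gamma>: "0 < \<gamma>" using False by (simp add: \<gamma>_def)
      have ba: "b2 * \<alpha> = b3 * \<beta> + \<gamma>" by (simp add: \<gamma>_def)
      have bb: "0 \<le> b3 * \<beta> * \<gamma>" using assms \<gamma> by simp
      have qs: "q / (2 * s) \<le> 1 / (4 * b2)" using True s assms by (simp add: field_simps)
      have "b2^2 * (\<alpha>^2 + \<beta>^2) = (b2 * \<alpha>)^2 + b2^2 * \<beta>^2" by (simp add: power_mult_distrib algebra_simps)
      also have "\<dots> = s * \<beta>^2 + (2 * (b3 * \<beta> * \<gamma>) + \<gamma>^2)"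
        unfolding ba s_def by (simp add: power2_eq_square algebra_simps)
      finally have "q / (2 * s) * (b2^2 * (\<alpha>^2 + \<beta>^2)) = q / (2 * s) * (s * \<beta>^2) + q / (2 * s) * (2 * (b3 * \<beta> * \<gamma>) + \<gamma>^2)"
        by (simp add: distrib_left)
      also have "\<dots> \<le> q * \<beta>^2 / 2 + 1 / (4 * b2) * (2 * (b3 * \<beta> * \<gamma>) + \<gamma>^2)"
        using qs bb s by (intro add_mono mult_right_mono) auto
      also have "\<dots> \<le> q * \<beta>^2 + 1 / b2 * (b3 * \<beta> * \<gamma> + \<gamma>^2)"
      proof (rule add_mono)
        have "2 * X + Y \<le> 4 * (X + Y)" if "0 \<le> X" "0 \<le> Y" for X Y :: real
          using that by (simp add: add_nonneg_nonneg algebra_simps)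
        from this[OF bb zero_le_power2[of \<gamma>]]
        have "2 * (b3 * \<beta> * \<gamma>) + \<gamma>^2 \<le> 4 * (b3 * \<beta> * \<gamma> + \<gamma>^2)" .
        then have "1 / (4 * b2) * (2 * (b3 * \<beta> * \<gamma>) + \<gamma>^2) \<le> 1 / (4 * b2) * (4 * (b3 * \<beta> * \<gamma> + \<gamma>^2))"
          using assms(2) by (intro mult_left_mono) auto
        also have "\<dots> = 1 / b2 * (b3 * \<beta> * \<gamma> + \<gamma>^2)"
          unfolding mult.assoc[symmetric] using assms(2) by simp
        finally show "1 / (4 * b2) * (2 * (b3 * \<beta> * \<gamma>) + \<gamma>^2) \<le> 1 / b2 * (b3 * \<beta> * \<gamma> + \<gamma>^2)" .
      qed (use q in simp)
      also have "1 / b2 * (b3 * \<beta> * \<gamma> + \<gamma>^2) = 1 / b2 * (b2 * \<alpha> * \<gamma>)"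
        unfolding ba by (simp add: power2_eq_square algebra_simps)
      also have "\<dots> = b2 * \<alpha>^2 - b3 * \<alpha> * \<beta>"
        using assms(2) by (simp add: \<gamma>_def power2_eq_square algebra_simps)
      finally show ?thesis by (simp add: lam1[OF True] mult_ac)
    qed
  next
    case False
    \<comment> \<open>\<open>X\<close> and \<open>Y\<close> are the real and imaginary parts of the
      product of \<open>(q - b2) + i b3\<close>, of modulus \<open>R\<close>, and
      \<open>(\<beta> + i \<alpha>)^2\<close>, of modulus \<open>\<alpha>^2 + \<beta>^2\<close>.
      Hence \<open>- X\<close> is at most the product of the moduli.\<close>
    define X where "X = (q - b2) * (\<beta>^2 - \<alpha>^2) - b3 * (2 * \<alpha> * \<beta>)"
    define Y where "Y = (q - b2) * (2 * \<alpha> * \<beta>) + b3 * (\<beta>^2 - \<alpha>^2)"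
    have brahmagupta: "(a * c - b * d)^2 + (a * d + b * c)^2 = (b^2 + a^2) * (c^2 + d^2)" for a b c d :: real
      by (simp add: power2_eq_square algebra_simps)
    have "(\<beta>^2 - \<alpha>^2)^2 + (2 * \<alpha> * \<beta>)^2 = (\<alpha>^2 + \<beta>^2)^2"
      by (simp add: power2_eq_square algebra_simps)
    then have "X^2 + Y^2 = (R * (\<alpha>^2 + \<beta>^2))^2"
      unfolding X_def Y_def brahmagupta power_mult_distrib[of R] R(2) by (simp only:)
    then have "(- X)^2 \<le> (R * (\<alpha>^2 + \<beta>^2))^2"
      unfolding power2_minus using zero_le_power2[of Y] by linarith
    moreover have "0 \<le> R * (\<alpha>^2 + \<beta>^2)"
      using R(1) by simp
    ultimately have "- X \<le> R * (\<alpha>^2 + \<beta>^2)"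
      by (rule power2_le_imp_le)
    then have x: "0 \<le> R * (\<alpha>^2 + \<beta>^2) + X" by simp
    have "0 \<le> 4 * lam_bar' b1 b2 b3 \<mu> * (\<alpha>^2 + \<beta>^2)"
      using big[OF False] assms by (intro mult_nonneg_nonneg) auto
    then have "2 * lam_bar' b1 b2 b3 \<mu> * (\<alpha>^2 + \<beta>^2) \<le> 4 * lam_bar' b1 b2 b3 \<mu> * (\<alpha>^2 + \<beta>^2)" by simp
    also have "\<dots> = (q + b2 - R) * (\<alpha>^2 + \<beta>^2)" by (simp add: lam2[OF False])
    also have "\<dots> = 2 * (q * \<beta>^2 + (b2 * \<alpha>^2 - b3 * \<alpha> * \<beta>)) - (R * (\<alpha>^2 + \<beta>^2) + X)"
      unfolding X_def by (simp add: algebra_simps)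
    also have "\<dots> \<le> 2 * (q * \<beta>^2 + (b2 * \<alpha>^2 - b3 * \<alpha> * \<beta>))"
      using x by simp
    also have "\<dots> \<le> 2 * (q * \<beta>^2 + max 0 (b2 * \<alpha>^2 - b3 * \<alpha> * \<beta>))"
      by (intro mult_left_mono add_left_mono) auto
    finally show "lam_bar' b1 b2 b3 \<mu> * (\<alpha>^2 + \<beta>^2) \<le> q * \<beta>^2 + max 0 (b2 * \<alpha>^2 - b3 * \<alpha> * \<beta>)" by simp
  qed
qed

lemma sq_minus_scalar_prod:
  fixes v w :: "real vec"
  assumes "v \<in> carrier_vec N" "w \<in> carrier_vec N"
  shows "(v - w) \<bullet> (v - w) = v \<bullet> v - 2 * (w \<bullet> v) + w \<bullet> w"
  using assms by (simp add: minus_scalar_prod_distrib[of _ N] scalar_prod_minus_distrib[of _ N] comm_scalar_prod[of w N v])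

lemma sq_add_scalar_prod:
  fixes v w :: "real vec"
  assumes "v \<in> carrier_vec N" "w \<in> carrier_vec N"
  shows "(v + w) \<bullet> (v + w) = v \<bullet> v + 2 * (v \<bullet> w) + w \<bullet> w"
  using assms by (simp add: add_scalar_prod_distrib[of _ N] scalar_prod_add_distrib[of _ N] comm_scalar_prod[of w N v])

text \<open>\<open>p\<close> is the orthogonal projection of \<open>z\<close> to the signals
  constant over the vertices, \<alpha> is its norm and \<beta> the norm of the rest
  \<open>r\<close>. The gap bounds the penalty through \<open>r\<close> alone, and on
  \<open>p\<close> the observations reduce to \<open>vstack\<close>. The relation
  \<open>\<alpha>^2 = T * (u \<bullet> u)\<close> accounts for the \<open>T\<close> and
  \<open>sqrt T\<close> in the conditions on \<open>b2\<close> and \<open>b3\<close>.\<close>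

lemma regularized_quadratic_form_lower_bound:
  fixes D :: "real mat" and n T :: nat
  assumes D: "D \<in> carrier_mat E T" and T: "0 < T"
    and gap: "\<And>w. w \<in> carrier_vec T \<Longrightarrow>
      b1 * (w \<bullet> w - (vec T (\<lambda>_. 1) \<bullet> w)^2 / T) \<le> (D *\<^sub>v w) \<bullet> (D *\<^sub>v w)"
    and Cs: "\<forall>t<T. Cs t \<in> carrier_mat (m t) n"
    and b: "0 < b1" "0 < b2" "0 < b3" and \<mu>: "0 < \<mu>"
    and b2: "b2 \<le> lambda_min (transpose_mat (vstack T n m Cs) * vstack T n m Cs) / T"
    and b3: "2 * spec_norm (blockdiag T n m Cs)
      * sqrt (lambda_max (transpose_mat (vstack T n m Cs) * vstack T n m Cs)) / sqrt T \<le> b3"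
    and z: "z \<in> carrier_vec (n * T)"
  shows "lam_bar' b1 b2 b3 \<mu> * (z \<bullet> z)
    \<le> \<mu> * ((kron D (1\<^sub>m n) *\<^sub>v z) \<bullet> (kron D (1\<^sub>m n) *\<^sub>v z))
      + (blockdiag T n m Cs *\<^sub>v z) \<bullet> (blockdiag T n m Cs *\<^sub>v z)"
proof -
  let ?M = "kron D (1\<^sub>m n)" and ?C = "blockdiag T n m Cs" and ?O = "vstack T n m Cs"
  let ?e = "vec T (\<lambda>_. 1) :: real vec" and ?N = "offs m T"
  let ?lmax = "lambda_max (transpose_mat ?O * ?O)"
  have C: "?C \<in> carrier_mat ?N (n * T)" and O: "?O \<in> carrier_mat ?N n"
    by (auto simp: blockdiag_def vstack_def)
  define u where "u = vec n (\<lambda>k. (?e \<bullet> slice T n k z) / T)"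
  define p where "p = replicate_vec T n u"
  define r where "r = z - p"
  have u: "u \<in> carrier_vec n" and p: "p \<in> carrier_vec (n * T)"
    by (auto simp: u_def p_def replicate_vec_def)
  have r: "r \<in> carrier_vec (n * T)" using z p by (auto simp: r_def)
  have p_slice: "slice T n k p \<bullet> w = u $ k * (?e \<bullet> w)" if "k < n" "w \<in> carrier_vec T" for k w
    using that by (simp add: scalar_prod_eq_sum[of _ T] slice_def p_def replicate_vec_def block_index_less sum_distrib_left)
  have e_slice: "?e \<bullet> slice T n k z = T * u $ k" if "k < n" for k
    using that T by (simp add: u_def)
  have "p \<bullet> z = (\<Sum>k<n. T * (u $ k)^2)"
    unfolding scalar_prod_slices[OF z]
    by (intro sum.cong refl) (simp add: p_slice e_slice power2_eq_square)
  then have pz: "p \<bullet> z = T * (u \<bullet> u)"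
    by (simp add: scalar_prod_eq_sum[OF u] power2_eq_square sum_distrib_left)
  have "p \<bullet> p = (\<Sum>k<n. T * (u $ k)^2)"
    unfolding scalar_prod_slices[OF p]
  proof (intro sum.cong refl)
    fix k assume k: "k \<in> {..<n}"
    have "?e \<bullet> slice T n k p = slice T n k p \<bullet> ?e" by (simp add: comm_scalar_prod[of _ T])
    also have "\<dots> = u $ k * (?e \<bullet> ?e)" using k by (intro p_slice) auto
    also have "?e \<bullet> ?e = T" by (simp add: scalar_prod_def)
    finally show "slice T n k p \<bullet> slice T n k p = T * (u $ k)^2"
      using k by (simp add: p_slice power2_eq_square)
  qed
  then have pp: "p \<bullet> p = T * (u \<bullet> u)"
    by (simp add: scalar_prod_eq_sum[OF u] power2_eq_square sum_distrib_left)
  have rr: "r \<bullet> r = z \<bullet> z - T * (u \<bullet> u)"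
    unfolding r_def sq_minus_scalar_prod[OF z p] pz pp by simp
  define \<alpha> where "\<alpha> = sqrt (T * (u \<bullet> u))"
  define \<beta> where "\<beta> = vnorm r"
  have \<alpha>: "0 \<le> \<alpha>" "\<alpha>^2 = T * (u \<bullet> u)" by (auto simp: \<alpha>_def scalar_prod_self_nonneg)
  have \<beta>: "0 \<le> \<beta>" "\<beta>^2 = r \<bullet> r" by (auto simp: \<beta>_def vnorm_nonneg vnorm_sq)
  have zz: "z \<bullet> z = \<alpha>^2 + \<beta>^2" using rr \<alpha> \<beta> by simp
  have "b1 * \<beta>^2 = b1 * (z \<bullet> z - (\<Sum>k<n. T * (u $ k)^2))"
    unfolding \<beta> rr by (simp add: scalar_prod_eq_sum[OF u] power2_eq_square sum_distrib_left)
  also have "\<dots> = (\<Sum>k<n. b1 * (slice T n k z \<bullet> slice T n k z - (?e \<bullet> slice T n k z)^2 / T))"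
    unfolding scalar_prod_slices[OF z] sum_subtractf[symmetric] sum_distrib_left
    using T by (intro sum.cong refl) (simp add: e_slice power2_eq_square)
  also have "\<dots> \<le> (?M *\<^sub>v z) \<bullet> (?M *\<^sub>v z)"
    unfolding kron_one_sq[OF D z] by (intro sum_mono gap) simp
  finally have Mz: "b1 * \<beta>^2 \<le> (?M *\<^sub>v z) \<bullet> (?M *\<^sub>v z)" .
  have Cp: "?C *\<^sub>v p = ?O *\<^sub>v u"
    unfolding p_def by (rule blockdiag_replicate_vec[OF T Cs u])
  have Cpp: "(?C *\<^sub>v p) \<bullet> (?C *\<^sub>v p) = u \<bullet> ((transpose_mat ?O * ?O) *\<^sub>v u)"
    unfolding Cp by (rule gram_mat(3)[OF O u, symmetric])
  have "b2 * \<alpha>^2 = (b2 * T) * (u \<bullet> u)" by (simp add: \<alpha>)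
  also have "\<dots> \<le> lambda_min (transpose_mat ?O * ?O) * (u \<bullet> u)"
    using b2 T by (intro mult_right_mono scalar_prod_self_nonneg) (simp add: field_simps)
  also have "\<dots> \<le> (?C *\<^sub>v p) \<bullet> (?C *\<^sub>v p)"
    unfolding Cpp by (rule lambda_min_le_quadratic_form[OF gram_mat(1,2)[OF O] u])
  finally have low: "b2 * \<alpha>^2 \<le> (?C *\<^sub>v p) \<bullet> (?C *\<^sub>v p)" .
  have "(vnorm (?C *\<^sub>v p))^2 \<le> ?lmax * (u \<bullet> u)"
    unfolding vnorm_sq Cpp by (rule quadratic_form_le_lambda_max[OF gram_mat(1,2)[OF O] u])
  then have "vnorm (?C *\<^sub>v p) \<le> sqrt (?lmax * (u \<bullet> u))"
    by (rule real_le_rsqrt)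
  also have "\<dots> = sqrt ?lmax / sqrt T * \<alpha>"
    using T by (simp add: \<alpha>_def real_sqrt_mult)
  finally have high: "vnorm (?C *\<^sub>v p) \<le> sqrt ?lmax / sqrt T * \<alpha>" .
  have Cpc: "?C *\<^sub>v p \<in> carrier_vec ?N" "?C *\<^sub>v r \<in> carrier_vec ?N" using C p r by auto
  have "\<bar>(?C *\<^sub>v p) \<bullet> (?C *\<^sub>v r)\<bar> \<le> vnorm (?C *\<^sub>v p) * vnorm (?C *\<^sub>v r)"
  proof (rule power2_le_imp_le)
    show "\<bar>(?C *\<^sub>v p) \<bullet> (?C *\<^sub>v r)\<bar>^2 \<le> (vnorm (?C *\<^sub>v p) * vnorm (?C *\<^sub>v r))^2"
      unfolding power2_abs power_mult_distrib vnorm_sq by (rule Cauchy_Schwarz_scalar_prod[OF Cpc])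
  qed (intro mult_nonneg_nonneg vnorm_nonneg)
  also have "\<dots> \<le> (sqrt ?lmax / sqrt T * \<alpha>) * (spec_norm ?C * \<beta>)"
    using high vnorm_mult_le_spec_norm[OF C r] vnorm_nonneg[of "?C *\<^sub>v p"] vnorm_nonneg[of "?C *\<^sub>v r"]
    by (intro mult_mono) (auto simp: \<beta>_def)
  finally have "2 * \<bar>(?C *\<^sub>v p) \<bullet> (?C *\<^sub>v r)\<bar> \<le> 2 * ((sqrt ?lmax / sqrt T * \<alpha>) * (spec_norm ?C * \<beta>))"
    by simp
  also have "\<dots> = 2 * spec_norm ?C * sqrt ?lmax / sqrt T * (\<alpha> * \<beta>)"
    by (simp add: mult_ac)
  also have "\<dots> \<le> b3 * (\<alpha> * \<beta>)"
    using b3 \<alpha> \<beta> by (intro mult_right_mono) auto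
  finally have cross: "2 * \<bar>(?C *\<^sub>v p) \<bullet> (?C *\<^sub>v r)\<bar> \<le> b3 * \<alpha> * \<beta>" by (simp add: mult_ac)
  have "z = p + r" using z p by (auto simp: r_def)
  then have "?C *\<^sub>v z = ?C *\<^sub>v p + ?C *\<^sub>v r" using C p r by (simp add: mult_add_distrib_mat_vec)
  then have "(?C *\<^sub>v z) \<bullet> (?C *\<^sub>v z)
    = (?C *\<^sub>v p) \<bullet> (?C *\<^sub>v p) + 2 * ((?C *\<^sub>v p) \<bullet> (?C *\<^sub>v r)) + (?C *\<^sub>v r) \<bullet> (?C *\<^sub>v r)"
    using sq_add_scalar_prod[OF Cpc] by simp
  \<comment> \<open>Of the three terms only the cross term can be negative; the square of
    \<open>?C *\<^sub>v r\<close> is dropped.\<close>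
  then have "b2 * \<alpha>^2 - b3 * \<alpha> * \<beta> \<le> (?C *\<^sub>v z) \<bullet> (?C *\<^sub>v z)"
    using low cross scalar_prod_self_nonneg[of "?C *\<^sub>v r"] by linarith
  then have Cz: "max 0 (b2 * \<alpha>^2 - b3 * \<alpha> * \<beta>) \<le> (?C *\<^sub>v z) \<bullet> (?C *\<^sub>v z)"
    using scalar_prod_self_nonneg[of "?C *\<^sub>v z"] by simp
  have "lam_bar' b1 b2 b3 \<mu> * (z \<bullet> z) \<le> \<mu> * (b1 * \<beta>^2) + max 0 (b2 * \<alpha>^2 - b3 * \<alpha> * \<beta>)"
    using lam_bar'_quadratic_le(1)[of \<mu> b1 b2 b3 \<alpha> \<beta>] b \<mu> \<alpha>(1) \<beta>(1) by (simp add: zz mult.assoc)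
  also have "\<dots> \<le> \<mu> * ((?M *\<^sub>v z) \<bullet> (?M *\<^sub>v z)) + (?C *\<^sub>v z) \<bullet> (?C *\<^sub>v z)"
    using Mz Cz \<mu> by (intro add_mono mult_left_mono) auto
  finally show ?thesis .
qed

subsection \<open>The trace of the inverse square\<close>

text \<open>Jensen's inequality for \<open>1 / x\<^sup>2\<close>, proved by summing the tangent-line bound at the mean.\<close>
lemma inverse_square_mean_le:
  fixes p x :: "'b \<Rightarrow> real"
  assumes S: "finite S" and p: "\<And>j. j \<in> S \<Longrightarrow> 0 \<le> p j" "sum p S = 1"
    and x: "\<And>j. j \<in> S \<Longrightarrow> 0 < x j"
  shows "1 / (\<Sum>j\<in>S. p j * x j)^2 \<le> (\<Sum>j\<in>S. p j / (x j)^2)"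
proof -
  define s where "s = (\<Sum>j\<in>S. p j * x j)"
  have "\<exists>j\<in>S. p j \<noteq> 0" using p(2) by (metis sum.neutral zero_neq_one)
  then obtain j where j: "j \<in> S" "0 < p j" using p(1) by force
  have "0 < p j * x j" using j x by simp
  also have "\<dots> \<le> s" unfolding s_def
    using S j by (intro member_le_sum) (auto intro: mult_nonneg_nonneg p(1) less_imp_le[OF x])
  finally have s: "0 < s" .
  \<comment> \<open>The left side is the tangent of \<open>1 / y^2\<close> at \<open>y = s\<close>.
    With denominators cleared, the difference is \<open>(s - y)^2 * (s + 2 * y)\<close>.\<close>
  have tangent: "(3 * s - 2 * y) / s^3 \<le> 1 / y^2" if "0 < y" for y
  proof -
    have "0 \<le> (s - y)^2 * (s + 2 * y)" using s that by simp
    also have "\<dots> = s^3 - (3 * s - 2 * y) * y^2"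
      by (simp add: power2_eq_square power3_eq_cube algebra_simps)
    finally have "(3 * s - 2 * y) * y^2 \<le> s^3" by simp
    then show ?thesis using s that by (simp add: pos_divide_le_eq pos_le_divide_eq)
  qed
  have "1 / s^2 = (\<Sum>j\<in>S. p j * ((3 * s - 2 * x j) / s^3))"
  proof -
    have "(\<Sum>j\<in>S. p j * ((3 * s - 2 * x j) / s^3)) = (\<Sum>j\<in>S. 3 * s * p j - 2 * (p j * x j)) / s^3"
      unfolding sum_divide_distrib by (intro sum.cong refl) (simp add: field_simps)
    also have "\<dots> = (3 * s * sum p S - 2 * s) / s^3"
      by (simp add: sum_subtractf sum_distrib_left[symmetric] s_def)
    also have "\<dots> = 1 / s^2" using s p(2) by (simp add: power2_eq_square power3_eq_cube)
    finally show ?thesis by simp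
  qed
  also have "\<dots> \<le> (\<Sum>j\<in>S. p j * (1 / (x j)^2))"
    using p(1) x by (intro sum_mono mult_left_mono tangent) auto
  finally show ?thesis by (simp add: s_def)
qed

text \<open>The squared coefficients of one orthonormal basis in another form a doubly stochastic matrix,
  so Jensen's inequality replaces an appeal to Weyl's eigenvalue inequalities.\<close>
lemma sum_inverse_square_eigenvalues_le:
  fixes D :: "real mat"
  assumes D: "D \<in> carrier_mat E T"
    and u: "orthonormal_eigenbasis T (transpose_mat D * D) u lam" and lam: "\<And>t. t < T \<Longrightarrow> 0 \<le> lam t"
    and v: "orthonormal_eigenbasis (n * T) A v a"
    and l: "0 < l" and \<mu>: "0 < \<mu>"
    and low: "\<And>z. z \<in> carrier_vec (n * T) \<Longrightarrow> l * (z \<bullet> z) \<le> z \<bullet> (A *\<^sub>v z)"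
      "\<And>z. z \<in> carrier_vec (n * T) \<Longrightarrow>
        \<mu> * ((kron D (1\<^sub>m n) *\<^sub>v z) \<bullet> (kron D (1\<^sub>m n) *\<^sub>v z)) \<le> z \<bullet> (A *\<^sub>v z)"
  shows "(\<Sum>i<n * T. 1 / (a i)^2) \<le> 4 * real n * (\<Sum>t<T. 1 / (l + \<mu> * lam t)^2)"
proof -
  let ?S = "{..<n} \<times> {..<T}"
  define q where "q i = (\<lambda>(k, t). (u t \<bullet> slice T n k (v i))^2)" for i
  define x where "x = (\<lambda>(k :: nat, t). l + \<mu> * lam t)"
  have on_u: "orthonormal_basis T u" and on_v: "orthonormal_basis (n * T) v"
    using u v by (auto dest: orthonormal_eigenbasisD)
  have x: "0 < x j" if "j \<in> ?S" for j
    using that lam \<mu> l by (auto simp: x_def intro!: add_pos_nonneg)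
  \<comment> \<open>The mean of \<open>x\<close> with weights \<open>q i\<close> is \<open>l\<close>
    plus \<mu> times the squared norm of \<open>kron D (1\<^sub>m n) *\<^sub>v v i\<close>. Each
    summand is at most \<open>a i\<close>, so the mean is at most \<open>2 * a i\<close>; inverting
    and squaring gives the factor 4.\<close>
  have each: "1 / (a i)^2 \<le> 4 * (\<Sum>j\<in>?S. q i j / (x j)^2)" if i: "i < n * T" for i
  proof -
    have vi: "v i \<in> carrier_vec (n * T)" "v i \<bullet> v i = 1" "v i \<bullet> (A *\<^sub>v v i) = a i"
      using orthonormal_eigenbasisD(2,3)[OF v i] orthonormal_basisD(2)[OF on_v i i] by auto
    have q1: "sum (q i) ?S = 1"
    proof -
      have "sum (q i) ?S = (\<Sum>k<n. \<Sum>t<T. (u t \<bullet> slice T n k (v i))^2)"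
        by (simp add: q_def sum.cartesian_product)
      also have "\<dots> = v i \<bullet> v i"
        unfolding scalar_prod_slices[OF vi(1)] by (simp add: parseval_self[OF on_u])
      finally show ?thesis using vi(2) by simp
    qed
    have Mv: "(kron D (1\<^sub>m n) *\<^sub>v v i) \<bullet> (kron D (1\<^sub>m n) *\<^sub>v v i)
      = (\<Sum>k<n. \<Sum>t<T. lam t * (u t \<bullet> slice T n k (v i))^2)"
      unfolding kron_one_sq[OF D vi(1)]
      by (intro sum.cong refl) (simp add: gram_mat(3)[OF D, symmetric] eigenbasis_quadratic_form[OF u gram_mat(1,2)[OF D]])
    have "(\<Sum>j\<in>?S. q i j * x j) = (\<Sum>j\<in>?S. l * q i j + \<mu> * (case j of (k, t) \<Rightarrow> lam t * (u t \<bullet> slice T n k (v i))^2))"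
      by (intro sum.cong refl) (auto simp: x_def q_def algebra_simps)
    also have "\<dots> = l * sum (q i) ?S + \<mu> * (\<Sum>(k, t)\<in>?S. lam t * (u t \<bullet> slice T n k (v i))^2)"
      by (simp add: sum.distrib sum_distrib_left)
    also have "\<dots> = l + \<mu> * ((kron D (1\<^sub>m n) *\<^sub>v v i) \<bullet> (kron D (1\<^sub>m n) *\<^sub>v v i))"
      by (simp add: q1 Mv sum.cartesian_product)
    also have "\<dots> \<le> 2 * a i"
      using low(1,2)[OF vi(1)] vi by simp
    finally have le: "(\<Sum>j\<in>?S. q i j * x j) \<le> 2 * a i" .
    have qn: "0 \<le> q i j" for j by (auto simp: q_def split: prod.splits)
    have "0 < (\<Sum>j\<in>?S. q i j * x j)"
    proof -
      have "l * sum (q i) ?S \<le> (\<Sum>j\<in>?S. q i j * x j)"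
        unfolding sum_distrib_left
      proof (rule sum_mono)
        fix j assume "j \<in> ?S"
        then have "l \<le> x j" using lam \<mu> by (auto simp: x_def)
        then show "l * q i j \<le> q i j * x j" using mult_right_mono[OF _ qn[of j]] by (simp add: mult.commute)
      qed
      then show ?thesis using l q1 by simp
    qed
    then have "1 / (2 * a i)^2 \<le> 1 / (\<Sum>j\<in>?S. q i j * x j)^2"
      using le by (intro divide_left_mono power_mono mult_pos_pos zero_less_power) auto
    also have "\<dots> \<le> (\<Sum>j\<in>?S. q i j / (x j)^2)"
      by (rule inverse_square_mean_le) (use qn q1 x in auto)
    finally show ?thesis by (simp add: power_mult_distrib)
  qed
  \<comment> \<open>The other half of double stochasticity is Parseval in the basis
    \<open>v\<close>, applied to the unit vector \<open>embed_slice T n k (u t)\<close>.\<close>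
  have col: "(\<Sum>i<n * T. q i j) = 1" if j: "j \<in> ?S" for j
  proof -
    obtain k t where kt: "j = (k, t)" "k < n" "t < T" using j by auto
    have ut: "u t \<in> carrier_vec T" "u t \<bullet> u t = 1"
      using orthonormal_basisD[OF on_u] kt(3) by auto
    have "(\<Sum>i<n * T. q i j) = (\<Sum>i<n * T. (v i \<bullet> embed_slice T n k (u t))^2)"
    proof (intro sum.cong refl)
      fix i assume "i \<in> {..<n * T}"
      then have vi: "v i \<in> carrier_vec (n * T)" using orthonormal_basisD(1)[OF on_v] by simp
      show "q i j = (v i \<bullet> embed_slice T n k (u t))^2"
        using embed_slice_scalar_prod[OF vi kt(2), of "u t"]
        by (simp add: q_def kt(1) comm_scalar_prod[OF vi embed_slice_carrier])
    qed
    also have "\<dots> = embed_slice T n k (u t) \<bullet> embed_slice T n k (u t)"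
      by (rule parseval_self[OF on_v, symmetric]) simp
    also have "\<dots> = 1" using embed_slice_sq[OF ut(1) kt(2)] ut(2) by simp
    finally show ?thesis .
  qed
  have "(\<Sum>i<n * T. 1 / (a i)^2) \<le> (\<Sum>i<n * T. 4 * (\<Sum>j\<in>?S. q i j / (x j)^2))"
    by (intro sum_mono each) simp
  also have "\<dots> = 4 * (\<Sum>j\<in>?S. (\<Sum>i<n * T. q i j) / (x j)^2)"
    unfolding sum_distrib_left[symmetric] sum_divide_distrib by (subst sum.swap) simp
  also have "(\<Sum>j\<in>?S. (\<Sum>i<n * T. q i j) / (x j)^2) = (\<Sum>(k, t)\<in>?S. 1 / (l + \<mu> * lam t)^2)"
    by (intro sum.cong refl) (auto simp: col x_def)
  also have "\<dots> = real n * (\<Sum>t<T. 1 / (l + \<mu> * lam t)^2)"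
    by (simp add: sum.cartesian_product[symmetric])
  finally show ?thesis by simp
qed

subsection \<open>The regularized least-squares estimator\<close>

lemma orthonormal_basis_ext:
  assumes v: "orthonormal_basis N v" and w: "w \<in> carrier_vec N" "z \<in> carrier_vec N"
    and eq: "\<And>i. i < N \<Longrightarrow> v i \<bullet> w = v i \<bullet> z"
  shows "w = z"
proof -
  have "(w - z) \<bullet> (w - z) = (\<Sum>i<N. (v i \<bullet> (w - z))^2)"
    using w by (intro parseval_self[OF v]) simp
  also have "\<dots> = 0"
    using w eq orthonormal_basisD(1)[OF v] by (simp add: scalar_prod_minus_distrib[of _ N])
  finally have "w - z = 0\<^sub>v N" using w by (intro scalar_prod_self_eq_0) auto
  then have d: "(w - z) $ i = 0" if "i < N" for i using that by simp
  show ?thesis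
  proof (rule eq_vecI)
    fix i assume "i < dim_vec z"
    then show "w $ i = z $ i" using d[of i] w by simp
  qed (use w in simp)
qed

text \<open>Lets linear systems with \<open>A\<close> be solved one eigencoordinate at a time, in
  place of forming an inverse matrix.\<close>

lemma orthonormal_basis_coeffs:
  assumes v: "orthonormal_basis N v"
  obtains z where "z \<in> carrier_vec N" "\<And>i. i < N \<Longrightarrow> v i \<bullet> z = c i"
proof -
  let ?U = "mat_of_cols N (map v [0..<N])" and ?c = "vec N c"
  note U = orthonormal_basis_mat[OF v]
  have UT: "transpose_mat ?U \<in> carrier_mat N N" using U(1) by simp
  have c: "?c \<in> carrier_vec N" by simp
  show ?thesis
  proof (rule that[of "?U *\<^sub>v ?c"])
    fix i assume i: "i < N"
    have "c i = (transpose_mat ?U * ?U *\<^sub>v ?c) $ i" using i by (simp add: U(2))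
    also have "\<dots> = (transpose_mat ?U *\<^sub>v (?U *\<^sub>v ?c)) $ i"
      by (simp only: assoc_mult_mat_vec[OF UT U(1) c])
    also have "\<dots> = col ?U i \<bullet> (?U *\<^sub>v ?c)" using i by simp
    also have "col ?U i = v i" using i orthonormal_basisD(1)[OF v] by simp
    finally show "v i \<bullet> (?U *\<^sub>v ?c) = c i" by simp
  qed (use U(1) in simp)
qed

lemma gram_mat_bilinear:
  fixes A :: "real mat"
  assumes A: "A \<in> carrier_mat m N" and z: "z \<in> carrier_vec N" "w \<in> carrier_vec N"
  shows "z \<bullet> ((transpose_mat A * A) *\<^sub>v w) = (A *\<^sub>v z) \<bullet> (A *\<^sub>v w)"
proof -
  have AT: "transpose_mat A \<in> carrier_mat N m" using A by simp
  show ?thesis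
    using scalar_prod_mult_mat_vec_swap[OF AT _ z(1), of "A *\<^sub>v w"] A z
    by (simp add: assoc_mult_mat_vec[OF AT A z(2)])
qed

lemma smult_mat_mult_vec:
  fixes A :: "real mat"
  assumes "A \<in> carrier_mat m N" "w \<in> carrier_vec N"
  shows "(c \<cdot>\<^sub>m A) *\<^sub>v w = c \<cdot>\<^sub>v (A *\<^sub>v w)"
  using assms by (intro eq_vecI) auto

lemma regularized_gram_mat:
  fixes M C :: "real mat" and \<mu> :: real
  assumes M: "M \<in> carrier_mat E N" and C: "C \<in> carrier_mat m N"
  defines "A \<equiv> smult_mat \<mu> (transpose_mat M * M) + transpose_mat C * C"
  shows "A \<in> carrier_mat N N" "transpose_mat A = A"
    and "z \<in> carrier_vec N \<Longrightarrow> w \<in> carrier_vec N \<Longrightarrow>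
      z \<bullet> (A *\<^sub>v w) = \<mu> * ((M *\<^sub>v z) \<bullet> (M *\<^sub>v w)) + (C *\<^sub>v z) \<bullet> (C *\<^sub>v w)"
proof -
  let ?MM = "transpose_mat M * M" and ?CC = "transpose_mat C * C"
  note G = gram_mat(1,2)[OF M] gram_mat(1,2)[OF C]
  show A: "A \<in> carrier_mat N N" using G by (simp add: A_def)
  have "transpose_mat A = transpose_mat (\<mu> \<cdot>\<^sub>m ?MM) + transpose_mat ?CC"
    unfolding A_def using G(1,3) by (intro transpose_add) auto
  also have "transpose_mat (\<mu> \<cdot>\<^sub>m ?MM) = \<mu> \<cdot>\<^sub>m transpose_mat ?MM" by auto
  finally show "transpose_mat A = A" by (simp only: G(2,4) A_def)
  assume z: "z \<in> carrier_vec N" and w: "w \<in> carrier_vec N"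
  have "A *\<^sub>v w = \<mu> \<cdot>\<^sub>v (?MM *\<^sub>v w) + ?CC *\<^sub>v w"
    unfolding A_def using G(1,3) w
    by (subst add_mult_distrib_mat_vec[of _ N N]) (auto simp: smult_mat_mult_vec[OF G(1)])
  then have "z \<bullet> (A *\<^sub>v w) = \<mu> * (z \<bullet> (?MM *\<^sub>v w)) + z \<bullet> (?CC *\<^sub>v w)"
    using G(1,3) z w by (simp add: scalar_prod_add_distrib[of _ N])
  then show "z \<bullet> (A *\<^sub>v w) = \<mu> * ((M *\<^sub>v z) \<bullet> (M *\<^sub>v w)) + (C *\<^sub>v z) \<bullet> (C *\<^sub>v w)"
    by (simp add: gram_mat_bilinear[OF M z w] gram_mat_bilinear[OF C z w])
qed

text \<open>Here \<open>x\<close> is any solution of the normal equations. Expanded around it, the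
  objective has no linear term and grows by half the quadratic form of \<open>A\<close> in
  \<open>w - x\<close>. Positive definiteness makes the minimiser unique, as the definite
  description in \<open>rls_est\<close> demands.\<close>

lemma rls_est_eq:
  fixes M C :: "real mat" and \<mu> :: real
  assumes M: "M \<in> carrier_mat E N" and C: "C \<in> carrier_mat m N" and y: "y \<in> carrier_vec m"
  defines "A \<equiv> smult_mat \<mu> (transpose_mat M * M) + transpose_mat C * C"
  assumes pos: "0 < l" "\<And>z. z \<in> carrier_vec N \<Longrightarrow> l * (z \<bullet> z) \<le> z \<bullet> (A *\<^sub>v z)"
    and x: "x \<in> carrier_vec N" "A *\<^sub>v x = transpose_mat C *\<^sub>v y"
  shows "rls_est C M \<mu> y = x"
proof -
  note A = regularized_gram_mat[OF M C, where \<mu> = \<mu>, folded A_def]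
  have expand: "rls_obj C M \<mu> y w = rls_obj C M \<mu> y x + 1/2 * ((w - x) \<bullet> (A *\<^sub>v (w - x)))"
    if w: "w \<in> carrier_vec N" for w
  proof -
    define h where "h = w - x"
    have h: "h \<in> carrier_vec N" using w x by (simp add: h_def)
    have wx: "w = x + h" using w x by (auto simp: h_def)
    define r where "r = y - C *\<^sub>v x"
    have r: "r \<in> carrier_vec m" and Cx: "C *\<^sub>v x \<in> carrier_vec m" and Ch: "C *\<^sub>v h \<in> carrier_vec m"
      and Mx: "M *\<^sub>v x \<in> carrier_vec E" and Mh: "M *\<^sub>v h \<in> carrier_vec E"
      using C M x y h by (auto simp: r_def)
    have "y - C *\<^sub>v w = r - C *\<^sub>v h"
      using y Cx Ch unfolding r_def wx mult_add_distrib_mat_vec[OF C x(1) h] by (intro eq_vecI) auto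
    then have 1: "(vnorm (y - C *\<^sub>v w))^2 = r \<bullet> r - 2 * ((C *\<^sub>v h) \<bullet> r) + (C *\<^sub>v h) \<bullet> (C *\<^sub>v h)"
      by (simp add: vnorm_sq sq_minus_scalar_prod[OF r Ch])
    have 2: "(vnorm (M *\<^sub>v w))^2 = (M *\<^sub>v x) \<bullet> (M *\<^sub>v x) + 2 * ((M *\<^sub>v x) \<bullet> (M *\<^sub>v h)) + (M *\<^sub>v h) \<bullet> (M *\<^sub>v h)"
      unfolding wx mult_add_distrib_mat_vec[OF M x(1) h] vnorm_sq by (rule sq_add_scalar_prod[OF Mx Mh])
    have "\<mu> * ((M *\<^sub>v h) \<bullet> (M *\<^sub>v x)) + (C *\<^sub>v h) \<bullet> (C *\<^sub>v x) = h \<bullet> (transpose_mat C *\<^sub>v y)"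
      using A(3)[OF h x(1)] x(2) by simp
    also have "\<dots> = (C *\<^sub>v h) \<bullet> y"
      using scalar_prod_mult_mat_vec_swap[of "transpose_mat C" N m y h] C y h by simp
    \<comment> \<open>The normal equations tested against \<open>h\<close>; this is what cancels the
      linear term.\<close>
    finally have 3: "\<mu> * ((M *\<^sub>v x) \<bullet> (M *\<^sub>v h)) = (C *\<^sub>v h) \<bullet> r"
      unfolding r_def using scalar_prod_minus_distrib[OF Ch y Cx] comm_scalar_prod[OF Mx Mh] by simp
    have 4: "h \<bullet> (A *\<^sub>v h) = \<mu> * ((M *\<^sub>v h) \<bullet> (M *\<^sub>v h)) + (C *\<^sub>v h) \<bullet> (C *\<^sub>v h)"
      by (rule A(3)[OF h h])
    have "rls_obj C M \<mu> y w = 1/2 * (r \<bullet> r) + \<mu>/2 * ((M *\<^sub>v x) \<bullet> (M *\<^sub>v x))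
      + (\<mu> * ((M *\<^sub>v x) \<bullet> (M *\<^sub>v h)) - (C *\<^sub>v h) \<bullet> r) + 1/2 * (h \<bullet> (A *\<^sub>v h))"
      unfolding rls_obj_def 1 2 4 by (simp add: field_simps)
    also have "\<dots> = rls_obj C M \<mu> y x + 1/2 * (h \<bullet> (A *\<^sub>v h))"
      unfolding 3 by (simp add: rls_obj_def vnorm_sq r_def)
    finally show ?thesis by (simp add: h_def)
  qed
  have nonneg: "0 \<le> l * ((w - x) \<bullet> (w - x))" for w
    using pos(1) scalar_prod_self_nonneg by (intro mult_nonneg_nonneg) auto
  have dimC: "dim_col C = N" using C by simp
  show ?thesis
    unfolding rls_est_def dimC
  proof (rule the_equality, intro conjI ballI)
    fix w :: "real vec" assume w: "w \<in> carrier_vec N"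
    have "0 \<le> (w - x) \<bullet> (A *\<^sub>v (w - x))"
      using order_trans[OF nonneg[of w] pos(2)[of "w - x"]] w x(1) by simp
    then show "rls_obj C M \<mu> y x \<le> rls_obj C M \<mu> y w"
      using expand[OF w] by simp
  next
    fix w :: "real vec" assume w: "w \<in> carrier_vec N \<and> (\<forall>v\<in>carrier_vec N. rls_obj C M \<mu> y w \<le> rls_obj C M \<mu> y v)"
    then have "(w - x) \<bullet> (A *\<^sub>v (w - x)) \<le> 0"
      using expand[of w] x(1) by force
    then have "l * ((w - x) \<bullet> (w - x)) \<le> 0"
      using order_trans[OF pos(2)[of "w - x"]] w x(1) by simp
    then have "(w - x) \<bullet> (w - x) = 0"
      using nonneg[of w] pos(1) by simp
    then have 0: "w - x = 0\<^sub>v N" using w x(1) by (intro scalar_prod_self_eq_0) auto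
    show "w = x"
    proof (rule eq_vecI)
      fix i assume "i < dim_vec x"
      then show "w $ i = x $ i" using arg_cong[OF 0, of "\<lambda>v. v $ i"] w x(1) by simp
    qed (use w x(1) in auto)
  qed (rule x(1))
qed

text \<open>The definition quantifies over unit vectors. Absorbing \<open>vnorm f\<close> into
  \<open>s\<close> extends it to nonzero \<open>f\<close>, and for \<open>f = 0\<close> the
  exponential is constantly 1.\<close>

lemma centered_subgaussian_linear:
  assumes sub: "centered_subgaussian P Y N \<sigma>" and "prob_space P" and f: "f \<in> carrier_vec N"
  shows "(\<lambda>\<omega>. f \<bullet> Y \<omega>) \<in> borel_measurable P"
    and "integrable P (\<lambda>\<omega>. exp (s * (f \<bullet> Y \<omega>)))"
    and "(\<integral>\<omega>. exp (s * (f \<bullet> Y \<omega>)) \<partial>P) \<le> exp (s^2 * (\<sigma>^2 * (f \<bullet> f)) / 2)"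
proof -
  interpret prob_space P by fact
  have Y: "Y \<omega> \<in> carrier_vec N" if "\<omega> \<in> space P" for \<omega>
    using sub that by (auto simp: centered_subgaussian_def)
  have "(\<lambda>\<omega>. \<Sum>i<N. f $ i * Y \<omega> $ i) \<in> borel_measurable P"
    using sub by (intro borel_measurable_sum borel_measurable_times borel_measurable_const)
      (auto simp: centered_subgaussian_def intro: borel_measurable_integrable)
  then show "(\<lambda>\<omega>. f \<bullet> Y \<omega>) \<in> borel_measurable P"
    by (rule measurable_cong[THEN iffD1, rotated]) (simp add: scalar_prod_eq_sum[OF Y])
  have "integrable P (\<lambda>\<omega>. exp (s * (f \<bullet> Y \<omega>))) \<and>
    (\<integral>\<omega>. exp (s * (f \<bullet> Y \<omega>)) \<partial>P) \<le> exp (s^2 * (\<sigma>^2 * (f \<bullet> f)) / 2)"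
  proof (cases "f = 0\<^sub>v N")
    case True
    have z: "exp (s * (f \<bullet> Y \<omega>)) = 1" if "\<omega> \<in> space P" for \<omega>
      using Y[OF that] True by simp
    have "integrable P (\<lambda>\<omega>. exp (s * (f \<bullet> Y \<omega>))) = integrable P (\<lambda>_. 1 :: real)"
      using z by (intro Bochner_Integration.integrable_cong) auto
    moreover have "(\<integral>\<omega>. exp (s * (f \<bullet> Y \<omega>)) \<partial>P) = (\<integral>\<omega>. 1 \<partial>P)"
      using z by (intro Bochner_Integration.integral_cong) auto
    ultimately show ?thesis using True by (simp add: prob_space)
  next
    case False
    then have nz: "vnorm f \<noteq> 0"
      using scalar_prod_self_eq_0[OF f] vnorm_sq[of f] by auto
    let ?u = "(1 / vnorm f) \<cdot>\<^sub>v f"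
    have u: "?u \<in> carrier_vec N" using f by simp
    have "?u \<bullet> ?u = (f \<bullet> f) / (vnorm f)^2" using f by (simp add: power2_eq_square)
    then have "(vnorm ?u)^2 = 1" using nz by (simp only: vnorm_sq[symmetric]) simp
    then have u1: "vnorm ?u = 1" using vnorm_nonneg[of ?u] by (simp add: power2_eq_1_iff)
    have eq: "exp (s * vnorm f * (?u \<bullet> Y \<omega>)) = exp (s * (f \<bullet> Y \<omega>))" if "\<omega> \<in> space P" for \<omega>
      using f Y[OF that] nz by simp
    have *: "integrable P (\<lambda>\<omega>. exp (s * vnorm f * (?u \<bullet> Y \<omega>)))"
      "(\<integral>\<omega>. exp (s * vnorm f * (?u \<bullet> Y \<omega>)) \<partial>P) \<le> exp ((s * vnorm f)^2 * \<sigma>^2 / 2)"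
      using sub u u1 unfolding centered_subgaussian_def by blast+
    have "integrable P (\<lambda>\<omega>. exp (s * vnorm f * (?u \<bullet> Y \<omega>))) = integrable P (\<lambda>\<omega>. exp (s * (f \<bullet> Y \<omega>)))"
      by (intro Bochner_Integration.integrable_cong refl eq)
    moreover have "(\<integral>\<omega>. exp (s * vnorm f * (?u \<bullet> Y \<omega>)) \<partial>P) = (\<integral>\<omega>. exp (s * (f \<bullet> Y \<omega>)) \<partial>P)"
      by (intro Bochner_Integration.integral_cong refl eq)
    moreover have "(s * vnorm f)^2 * \<sigma>^2 / 2 = s^2 * (\<sigma>^2 * (f \<bullet> f)) / 2"
      by (simp add: power_mult_distrib vnorm_sq)
    ultimately show ?thesis using * by (simp only: simp_thms)
  qed
  then show "integrable P (\<lambda>\<omega>. exp (s * (f \<bullet> Y \<omega>)))"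
    and "(\<integral>\<omega>. exp (s * (f \<bullet> Y \<omega>)) \<partial>P) \<le> exp (s^2 * (\<sigma>^2 * (f \<bullet> f)) / 2)" by auto
qed

text \<open>The error solves the normal equations with right-hand side
  \<open>C\<^sup>T \<eta> - \<mu> M\<^sup>T M x\<close>; its two parts are bounded separately.\<close>
lemma rls_error_bound:
  fixes M C :: "real mat" and \<mu> :: real
  assumes M: "M \<in> carrier_mat E N" and C: "C \<in> carrier_mat m N"
    and x: "x \<in> carrier_vec N" and \<mu>: "0 < \<mu>"
  defines "A \<equiv> smult_mat \<mu> (transpose_mat M * M) + transpose_mat C * C"
  assumes pos: "0 < l" "\<And>z. z \<in> carrier_vec N \<Longrightarrow> l * (z \<bullet> z) \<le> z \<bullet> (A *\<^sub>v z)"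
    and v: "orthonormal_eigenbasis N A v a"
  obtains e where "(\<Sum>i<N. (e i)^2) \<le> \<mu> / l * (vnorm (M *\<^sub>v x))^2"
    "\<And>\<eta>. \<eta> \<in> carrier_vec m \<Longrightarrow>
      (vnorm (rls_est C M \<mu> (C *\<^sub>v x + \<eta>) - x))^2
        = (\<Sum>i<N. (((1 / a i) \<cdot>\<^sub>v (C *\<^sub>v v i)) \<bullet> \<eta> - e i)^2)"
proof -
  note A = regularized_gram_mat[OF M C, where \<mu> = \<mu>, folded A_def]
  have on: "orthonormal_basis N v" by (rule orthonormal_eigenbasisD(1)[OF v])
  have vc: "v i \<in> carrier_vec N" if "i < N" for i using orthonormal_basisD(1)[OF on that] .
  have a: "0 < a i" if "i < N" for i
  proof -
    have "l \<le> a i"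
      using pos(2)[OF vc[OF that]] orthonormal_eigenbasisD(3)[OF v that] orthonormal_basisD(2)[OF on that that] vc[OF that]
      by simp
    then show ?thesis using pos(1) by simp
  qed
  have solve: "\<exists>z\<in>carrier_vec N. A *\<^sub>v z = w \<and> (\<forall>i<N. v i \<bullet> z = (v i \<bullet> w) / a i)" if w: "w \<in> carrier_vec N" for w
  proof -
    obtain z where z: "z \<in> carrier_vec N" "\<And>i. i < N \<Longrightarrow> v i \<bullet> z = (v i \<bullet> w) / a i"
      by (rule orthonormal_basis_coeffs[OF on, of "\<lambda>i. (v i \<bullet> w) / a i"]) blast
    have "A *\<^sub>v z = w"
    proof (rule orthonormal_basis_ext[OF on])
      fix i assume i: "i < N"
      show "v i \<bullet> (A *\<^sub>v z) = v i \<bullet> w"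
        using eigenbasis_coeff[OF v A(1,2) z(1) i] z(2)[OF i] a[OF i] by simp
    qed (use A(1) z(1) w in auto)
    then show ?thesis using z by blast
  qed
  let ?MMx = "transpose_mat M *\<^sub>v (M *\<^sub>v x)"
  have Mx: "M *\<^sub>v x \<in> carrier_vec E" and Cx: "C *\<^sub>v x \<in> carrier_vec m" using M C x by auto
  have MMx: "\<mu> \<cdot>\<^sub>v ?MMx \<in> carrier_vec N" using M Mx by auto
  \<comment> \<open>Minus the error that remains without noise. Its coefficients along
    \<open>v\<close> become \<open>e\<close>.\<close>
  obtain b where b: "b \<in> carrier_vec N" "A *\<^sub>v b = \<mu> \<cdot>\<^sub>v ?MMx"
      "\<And>i. i < N \<Longrightarrow> v i \<bullet> b = (v i \<bullet> (\<mu> \<cdot>\<^sub>v ?MMx)) / a i"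
    using solve[OF MMx] by blast
  have dot_M: "w \<bullet> (\<mu> \<cdot>\<^sub>v ?MMx) = \<mu> * ((M *\<^sub>v w) \<bullet> (M *\<^sub>v x))" if w: "w \<in> carrier_vec N" for w
    using scalar_prod_mult_mat_vec_swap[of "transpose_mat M" N E "M *\<^sub>v x" w] M Mx w by simp
  have dot_C: "w \<bullet> (transpose_mat C *\<^sub>v \<eta>) = (C *\<^sub>v w) \<bullet> \<eta>" if "w \<in> carrier_vec N" "\<eta> \<in> carrier_vec m" for w \<eta>
    using scalar_prod_mult_mat_vec_swap[of "transpose_mat C" N m \<eta> w] C that by simp
  show ?thesis
  proof (rule that[of "\<lambda>i. v i \<bullet> b"])
    define Q where "Q = b \<bullet> (A *\<^sub>v b)"
    define S where "S = (M *\<^sub>v x) \<bullet> (M *\<^sub>v x)"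
    have Mb: "M *\<^sub>v b \<in> carrier_vec E" using M b(1) by simp
    have S: "0 \<le> S" unfolding S_def by (rule scalar_prod_self_nonneg)
    have Q1: "Q = \<mu> * ((M *\<^sub>v b) \<bullet> (M *\<^sub>v x))" unfolding Q_def b(2) by (rule dot_M[OF b(1)])
    have Q2: "\<mu> * ((M *\<^sub>v b) \<bullet> (M *\<^sub>v b)) \<le> Q"
      unfolding Q_def A(3)[OF b(1) b(1)] using scalar_prod_self_nonneg by simp
    \<comment> \<open>Cauchy-Schwarz and \<open>Q2\<close> give
      \<open>Q^2 \<le> (\<mu> * S) * Q\<close>. Cancelling \<open>Q\<close> bounds the bias in the
      norm induced by \<open>A\<close>, and passing to the Euclidean norm then costs a single factor
      \<open>1 / l\<close>.\<close>
    have "Q^2 = \<mu>^2 * ((M *\<^sub>v b) \<bullet> (M *\<^sub>v x))^2" unfolding Q1 by (simp add: power_mult_distrib)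
    also have "\<dots> \<le> \<mu>^2 * (((M *\<^sub>v b) \<bullet> (M *\<^sub>v b)) * S)"
      unfolding S_def by (intro mult_left_mono Cauchy_Schwarz_scalar_prod[OF Mb Mx]) simp
    also have "\<dots> = (\<mu> * S) * (\<mu> * ((M *\<^sub>v b) \<bullet> (M *\<^sub>v b)))"
      by (simp add: power2_eq_square mult_ac)
    also have "\<dots> \<le> (\<mu> * S) * Q"
      using Q2 \<mu> S by (intro mult_left_mono) auto
    finally have "Q * Q \<le> (\<mu> * S) * Q" by (simp add: power2_eq_square)
    moreover have lQ: "l * (b \<bullet> b) \<le> Q" unfolding Q_def by (rule pos(2)[OF b(1)])
    then have "0 \<le> Q"
      using mult_nonneg_nonneg[OF less_imp_le[OF pos(1)] scalar_prod_self_nonneg[of b]] by linarith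
    ultimately have "Q \<le> \<mu> * S"
      using \<mu> S by (cases "Q = 0") (auto simp: mult_le_cancel_right)
    then have "l * (b \<bullet> b) \<le> \<mu> * S" using lQ by simp
    then have "b \<bullet> b \<le> \<mu> / l * S" using pos(1) by (simp add: field_simps)
    then show "(\<Sum>i<N. (v i \<bullet> b)^2) \<le> \<mu> / l * (vnorm (M *\<^sub>v x))^2"
      unfolding vnorm_sq S_def parseval_self[OF on b(1)] .
  next
    fix \<eta> :: "real vec" assume \<eta>: "\<eta> \<in> carrier_vec m"
    let ?y = "C *\<^sub>v x + \<eta>"
    have y: "?y \<in> carrier_vec m" using Cx \<eta> by simp
    have CTy: "transpose_mat C *\<^sub>v ?y \<in> carrier_vec N" using C y by auto
    obtain z where z: "z \<in> carrier_vec N" "A *\<^sub>v z = transpose_mat C *\<^sub>v ?y"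
        "\<And>i. i < N \<Longrightarrow> v i \<bullet> z = (v i \<bullet> (transpose_mat C *\<^sub>v ?y)) / a i"
      using solve[OF CTy] by blast
    have est: "rls_est C M \<mu> ?y = z"
      by (rule rls_est_eq[OF M C y pos(1) _ z(1)]) (use pos(2) z(2) in \<open>auto simp: A_def\<close>)
    have coeff: "v i \<bullet> (z - x) = ((1 / a i) \<cdot>\<^sub>v (C *\<^sub>v v i)) \<bullet> \<eta> - v i \<bullet> b" if i: "i < N" for i
    proof -
      have Cv: "C *\<^sub>v v i \<in> carrier_vec m" using C vc[OF i] by simp
      have "a i * (v i \<bullet> x) = v i \<bullet> (A *\<^sub>v x)"
        by (rule eigenbasis_coeff[OF v A(1,2) x i, symmetric])
      also have "\<dots> = \<mu> * ((M *\<^sub>v v i) \<bullet> (M *\<^sub>v x)) + (C *\<^sub>v v i) \<bullet> (C *\<^sub>v x)"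
        by (rule A(3)[OF vc[OF i] x])
      finally have "v i \<bullet> x = (\<mu> * ((M *\<^sub>v v i) \<bullet> (M *\<^sub>v x)) + (C *\<^sub>v v i) \<bullet> (C *\<^sub>v x)) / a i"
        using a[OF i] by (simp add: field_simps)
      moreover have "v i \<bullet> z = ((C *\<^sub>v v i) \<bullet> (C *\<^sub>v x) + (C *\<^sub>v v i) \<bullet> \<eta>) / a i"
        unfolding z(3)[OF i] dot_C[OF vc[OF i] y] scalar_prod_add_distrib[OF Cv Cx \<eta>] ..
      moreover have "v i \<bullet> b = \<mu> * ((M *\<^sub>v v i) \<bullet> (M *\<^sub>v x)) / a i"
        unfolding b(3)[OF i] dot_M[OF vc[OF i]] ..
      moreover have "v i \<bullet> (z - x) = v i \<bullet> z - v i \<bullet> x"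
        by (rule scalar_prod_minus_distrib[OF vc[OF i] z(1) x])
      moreover have "((1 / a i) \<cdot>\<^sub>v (C *\<^sub>v v i)) \<bullet> \<eta> = ((C *\<^sub>v v i) \<bullet> \<eta>) / a i"
        using Cv \<eta> by simp
      ultimately show ?thesis by (simp add: add_divide_distrib)
    qed
    have "(vnorm (z - x))^2 = (\<Sum>i<N. (v i \<bullet> (z - x))^2)"
      unfolding vnorm_sq using z(1) x by (intro parseval_self[OF on]) simp
    then show "(vnorm (rls_est C M \<mu> ?y - x))^2 = (\<Sum>i<N. (((1 / a i) \<cdot>\<^sub>v (C *\<^sub>v v i)) \<bullet> \<eta> - v i \<bullet> b)^2)"
      unfolding est by (simp add: coeff)
  qed
qed

section \<open>The eigenvalue bound and the error bound with high probability\<close>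

theorem theorem1:
  fixes n T :: nat and es :: "(nat \<times> nat) list" and m :: "nat \<Rightarrow> nat"
    and Cs :: "nat \<Rightarrow> real mat" and x :: "real Matrix.vec"
    and P :: "'a measure" and \<eta> :: "'a \<Rightarrow> real Matrix.vec"
    and \<sigma> S_T b1 b2 b3 \<mu> :: real
  defines "D \<equiv> incidence_mat T es"
  defines "L \<equiv> transpose_mat D * D"
  defines "M \<equiv> kron D (one_mat n)"
  defines "C \<equiv> blockdiag T n m Cs"
  defines "O_T \<equiv> vstack T n m Cs"
  defines "lam \<equiv> eigvals_desc L"
  defines "lbar' \<equiv> lam_bar' b1 b2 b3 \<mu>"
  defines "lbar \<equiv> max lbar' (lambda_min (transpose_mat C * C))"
  defines "y \<equiv> (\<lambda>\<omega>. C *\<^sub>v x + \<eta> \<omega>)"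
  defines "xhat \<equiv> (\<lambda>\<omega>. rls_est C M \<mu> (y \<omega>))"
  assumes "n \<ge> 1" and "T \<ge> 2"
    and "oriented_simple_graph T es" and "graph_connected T es"
    and "\<forall>t<T. Cs t \<in> carrier_mat (m t) n"
    and "x \<in> carrier_vec (n * T)"
    and "lambda_min (transpose_mat O_T * O_T) > 0"
    and "prob_space P"
    and "centered_subgaussian P \<eta> (offs m T) \<sigma>"
    and "(vnorm (M *\<^sub>v x))^2 \<le> S_T"
    and "b1 > 0" and "b2 > 0" and "b3 > 0"
    and "lam ! (T - 2) \<ge> b1"
    and "lambda_min (transpose_mat O_T * O_T) / T \<ge> b2"
    and "2 * spec_norm C * sqrt (lambda_max (transpose_mat O_T * O_T)) / sqrt T \<le> b3"
    and "\<mu> > 0"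
  shows "lambda_min (smult_mat \<mu> (transpose_mat M * M) + transpose_mat C * C) \<ge> lbar
    \<and> lbar' > 0
    \<and> (\<mu> * b1 \<ge> b2 + b3^2 / b2 \<longrightarrow> lbar' \<ge> b2 / 4)
    \<and> (\<forall>\<delta>. 0 < \<delta> \<and> \<delta> < exp (-1) \<longrightarrow>
         measure P {\<omega> \<in> space P.
           (vnorm (xhat \<omega> - x))^2 \<le> 4 * \<mu> / lbar * S_T
             + 40 * n * \<sigma>^2 * (spec_norm C)^2
               * ((\<Sum>t<T - 1. 1 / (lbar + \<mu> * lam ! t)^2) + 1 / lbar^2) * ln (1 / \<delta>)}
         \<ge> 1 - \<delta>)"
proof -
  interpret prob_space P by fact
  let ?N = "n * T" and ?m = "offs m T" and ?E = "length es"
  have T: "0 < T" and n: "0 < n" and N: "0 < ?N" using \<open>n \<ge> 1\<close> \<open>T \<ge> 2\<close> by auto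
  have D: "D \<in> carrier_mat ?E T" by (simp add: D_def incidence_mat_def)
  have M: "M \<in> carrier_mat (n * ?E) ?N" unfolding M_def by (rule kron_one_carrier[OF D])
  have C: "C \<in> carrier_mat ?m ?N" by (simp add: C_def blockdiag_def)
  have ones: "D *\<^sub>v vec T (\<lambda>_. 1) = 0\<^sub>v ?E"
    unfolding D_def by (rule incidence_mat_ones) fact
  obtain u ev where u: "orthonormal_eigenbasis T (transpose_mat D * D) u ev"
    and desc: "\<And>i j. i \<le> j \<Longrightarrow> j < T \<Longrightarrow> ev j \<le> ev i"
    by (rule spectral_theorem[OF gram_mat(1,2)[OF D]]) blast
  have "lam = map ev [0..<T]"
    unfolding lam_def L_def by (rule eigvals_desc_eigenbasis[OF u gram_mat(1)[OF D]]) (rule desc)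
  then have lam: "lam ! t = ev t" if "t < T" for t using that by simp
  have b1: "b1 \<le> ev (T - 2)" using \<open>lam ! (T - 2) \<ge> b1\<close> lam[of "T - 2"] T by simp
  note gap = laplacian_gap[OF D \<open>T \<ge> 2\<close> ones u desc \<open>b1 > 0\<close> b1]
  have ev_nonneg: "0 \<le> ev t" if "t < T" for t
    using desc[of t "T - 1"] gap(1) that T by simp
  define A where "A = smult_mat \<mu> (transpose_mat M * M) + transpose_mat C * C"
  note A = regularized_gram_mat[OF M C, where \<mu> = \<mu>, folded A_def]
  have \<mu>b: "0 < \<mu> * b1" using \<open>\<mu> > 0\<close> \<open>b1 > 0\<close> by simp
  note bar = lam_bar'_quadratic_le(2,3)[OF \<mu>b \<open>b2 > 0\<close> \<open>b3 > 0\<close> order_refl order_refl, folded lbar'_def]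
  have lbar: "0 < lbar" using bar(1) by (simp add: lbar_def)
  have low_M: "\<mu> * ((M *\<^sub>v z) \<bullet> (M *\<^sub>v z)) \<le> z \<bullet> (A *\<^sub>v z)" if "z \<in> carrier_vec ?N" for z
    unfolding A(3)[OF that that] using scalar_prod_self_nonneg by simp
  have low: "lbar * (z \<bullet> z) \<le> z \<bullet> (A *\<^sub>v z)" if z: "z \<in> carrier_vec ?N" for z
  proof -
    have "lbar' * (z \<bullet> z) \<le> z \<bullet> (A *\<^sub>v z)"
      unfolding A(3)[OF z z] lbar'_def M_def C_def
      by (rule regularized_quadratic_form_lower_bound[OF D T gap(2)])
        (use assms z in \<open>auto simp: C_def O_T_def\<close>)
    moreover have "lambda_min (transpose_mat C * C) * (z \<bullet> z) \<le> z \<bullet> (A *\<^sub>v z)"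
    proof -
      have "lambda_min (transpose_mat C * C) * (z \<bullet> z) \<le> z \<bullet> ((transpose_mat C * C) *\<^sub>v z)"
        by (rule lambda_min_le_quadratic_form[OF gram_mat(1,2)[OF C] z])
      also have "\<dots> = (C *\<^sub>v z) \<bullet> (C *\<^sub>v z)" by (rule gram_mat(3)[OF C z])
      also have "\<dots> \<le> z \<bullet> (A *\<^sub>v z)"
        unfolding A(3)[OF z z] using \<open>\<mu> > 0\<close> scalar_prod_self_nonneg[of "M *\<^sub>v z"] by simp
      finally show ?thesis .
    qed
    ultimately show ?thesis by (auto simp: lbar_def max_def)
  qed
  have first: "lbar \<le> lambda_min A" by (rule lambda_min_greatest[OF A(1,2) N low])
  obtain v a where v: "orthonormal_eigenbasis ?N A v a"
    using orthonormal_eigenbasis_exists[OF A(1,2)] by blast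
  obtain e where e: "(\<Sum>i<?N. (e i)^2) \<le> \<mu> / lbar * (vnorm (M *\<^sub>v x))^2"
    and err: "\<And>\<eta>. \<eta> \<in> carrier_vec ?m \<Longrightarrow>
      (vnorm (rls_est C M \<mu> (C *\<^sub>v x + \<eta>) - x))^2
        = (\<Sum>i<?N. (((1 / a i) \<cdot>\<^sub>v (C *\<^sub>v v i)) \<bullet> \<eta> - e i)^2)"
    by (rule rls_error_bound[OF M C \<open>x \<in> carrier_vec (n * T)\<close> \<open>\<mu> > 0\<close> lbar _ v[unfolded A_def]])
      (use low in \<open>auto simp: A_def\<close>)
  define f where "f i = (1 / a i) \<cdot>\<^sub>v (C *\<^sub>v v i)" for i
  have vi: "v i \<in> carrier_vec ?N" "v i \<bullet> v i = 1" if "i < ?N" for i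
    using orthonormal_basisD[OF orthonormal_eigenbasisD(1)[OF v]] that by auto
  have f: "f i \<in> carrier_vec ?m" if "i < ?N" for i
    using C vi(1)[OF that] by (simp add: f_def)
  note lin = centered_subgaussian_linear[OF \<open>centered_subgaussian P \<eta> (offs m T) \<sigma>\<close> \<open>prob_space P\<close> f]
  have \<eta>: "\<eta> \<omega> \<in> carrier_vec ?m" if "\<omega> \<in> space P" for \<omega>
    using \<open>centered_subgaussian P \<eta> (offs m T) \<sigma>\<close> that by (auto simp: centered_subgaussian_def)
  define R where "R = (\<Sum>t<T - 1. 1 / (lbar + \<mu> * lam ! t)^2) + 1 / lbar^2"
  \<comment> \<open>The last Laplacian eigenvalue is 0, so its summand is the separate term
    \<open>1 / lbar^2\<close>.\<close>
  have R: "(\<Sum>t<T. 1 / (lbar + \<mu> * ev t)^2) = R"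
  proof -
    have "{..<T} = insert (T - 1) {..<T - 1}" using T by auto
    then show ?thesis using gap(1) by (simp add: R_def lam)
  qed
  have trace: "(\<Sum>i<?N. \<sigma>^2 * (f i \<bullet> f i)) \<le> 4 * real n * \<sigma>^2 * (spec_norm C)^2 * R"
  proof -
    have "(\<Sum>i<?N. \<sigma>^2 * (f i \<bullet> f i)) \<le> (\<Sum>i<?N. \<sigma>^2 * ((spec_norm C)^2 * (1 / (a i)^2)))"
    proof (intro sum_mono mult_left_mono)
      fix i assume "i \<in> {..<?N}"
      then have i: "i < ?N" by simp
      have Cv: "C *\<^sub>v v i \<in> carrier_vec ?m" using C vi(1)[OF i] by simp
      have "f i \<bullet> f i = (C *\<^sub>v v i) \<bullet> (C *\<^sub>v v i) * (1 / (a i)^2)"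
        using Cv by (simp add: f_def power2_eq_square)
      also have "\<dots> \<le> (spec_norm C)^2 * (1 / (a i)^2)"
        using mult_mat_vec_sq_le_spec_norm[OF C vi(1)[OF i]] vi(2)[OF i]
        by (intro mult_right_mono) auto
      finally show "f i \<bullet> f i \<le> (spec_norm C)^2 * (1 / (a i)^2)" .
    qed simp
    also have "\<dots> = \<sigma>^2 * ((spec_norm C)^2 * (\<Sum>i<?N. 1 / (a i)^2))"
      by (simp only: sum_distrib_left)
    also have "\<dots> \<le> \<sigma>^2 * ((spec_norm C)^2 * (4 * real n * R))"
      using sum_inverse_square_eigenvalues_le[OF D u ev_nonneg v lbar \<open>\<mu> > 0\<close> low, folded M_def, OF _ _ low_M] R
      by (intro mult_left_mono) auto
    finally show ?thesis by (simp add: mult_ac)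
  qed
  \<comment> \<open>The 2 arises from squaring a difference; since the bias bound is nonnegative, it
    may be raised to the 4 of the statement.\<close>
  have bias: "2 * (\<Sum>i<?N. (e i)^2) \<le> 4 * \<mu> / lbar * S_T"
  proof -
    have "\<mu> / lbar * (vnorm (M *\<^sub>v x))^2 \<le> \<mu> / lbar * S_T"
      using \<open>(vnorm (M *\<^sub>v x))^2 \<le> S_T\<close> \<open>\<mu> > 0\<close> lbar by (intro mult_left_mono) auto
    moreover have "0 \<le> \<mu> / lbar * (vnorm (M *\<^sub>v x))^2" using \<open>\<mu> > 0\<close> lbar by simp
    moreover have "4 * \<mu> / lbar * S_T = 4 * (\<mu> / lbar * S_T)" by simp
    ultimately show ?thesis using e by linarith
  qed
  have second: "1 - \<delta> \<le> prob {\<omega> \<in> space P. (vnorm (xhat \<omega> - x))^2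
      \<le> 4 * \<mu> / lbar * S_T + 40 * n * \<sigma>^2 * (spec_norm C)^2 * R * ln (1 / \<delta>)}"
    if \<delta>: "0 < \<delta>" "\<delta> < exp (- 1)" for \<delta>
  proof -
    \<comment> \<open>The condition on \<delta> puts \<open>t\<close> above 1, within the range of
      the tail bound.\<close>
    define t where "t = ln (1 / \<delta>)"
    have exp_t: "exp (- t) = \<delta>" using \<delta> by (simp add: t_def ln_div)
    then have "exp (- t) < exp (- 1)" using \<delta> by simp
    then have t: "1 \<le> t" by simp
    let ?good = "{\<omega> \<in> space P. (\<Sum>i<?N. (f i \<bullet> \<eta> \<omega>)^2) \<le> 5 * t * (\<Sum>i<?N. \<sigma>^2 * (f i \<bullet> f i))}"
    let ?event = "{\<omega> \<in> space P. (vnorm (xhat \<omega> - x))^2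
      \<le> 4 * \<mu> / lbar * S_T + 40 * n * \<sigma>^2 * (spec_norm C)^2 * R * ln (1 / \<delta>)}"
    have sq: "(vnorm (xhat \<omega> - x))^2 = (\<Sum>i<?N. (f i \<bullet> \<eta> \<omega> - e i)^2)" if "\<omega> \<in> space P" for \<omega>
      unfolding xhat_def y_def f_def by (rule err[OF \<eta>[OF that]])
    \<comment> \<open>The definite description behind \<open>xhat\<close> hides measurability; it is
      read off from the explicit sum of squares.\<close>
    have "(\<lambda>\<omega>. \<Sum>i<?N. (f i \<bullet> \<eta> \<omega> - e i)^2) \<in> borel_measurable P"
      using lin(1) by (intro borel_measurable_sum borel_measurable_power borel_measurable_diff) auto
    then have "(\<lambda>\<omega>. (vnorm (xhat \<omega> - x))^2) \<in> borel_measurable P"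
      by (rule measurable_cong[THEN iffD2, rotated]) (rule sq)
    then have meas: "?event \<in> sets P" by measurable
    have "?good \<subseteq> ?event"
    proof
      fix \<omega> assume "\<omega> \<in> ?good"
      then have \<omega>: "\<omega> \<in> space P" "(\<Sum>i<?N. (f i \<bullet> \<eta> \<omega>)^2) \<le> 5 * t * (\<Sum>i<?N. \<sigma>^2 * (f i \<bullet> f i))"
        by auto
      have ineq: "(p - q)^2 \<le> 2 * q^2 + 2 * p^2" for p q :: real
        using zero_le_power2[of "p + q"] by (simp add: power2_eq_square algebra_simps)
      have "(vnorm (xhat \<omega> - x))^2 \<le> (\<Sum>i<?N. 2 * (e i)^2 + 2 * (f i \<bullet> \<eta> \<omega>)^2)"
        unfolding sq[OF \<omega>(1)] by (intro sum_mono ineq)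
      also have "\<dots> = 2 * (\<Sum>i<?N. (e i)^2) + 2 * (\<Sum>i<?N. (f i \<bullet> \<eta> \<omega>)^2)"
        by (simp add: sum.distrib sum_distrib_left)
      also have "\<dots> \<le> 4 * \<mu> / lbar * S_T + 2 * (5 * t * (4 * real n * \<sigma>^2 * (spec_norm C)^2 * R))"
      proof (intro add_mono bias mult_left_mono)
        have "5 * t * (\<Sum>i<?N. \<sigma>^2 * (f i \<bullet> f i)) \<le> 5 * t * (4 * real n * \<sigma>^2 * (spec_norm C)^2 * R)"
          using t by (intro mult_left_mono trace) auto
        with \<omega>(2) show "(\<Sum>i<?N. (f i \<bullet> \<eta> \<omega>)^2) \<le> 5 * t * (4 * real n * \<sigma>^2 * (spec_norm C)^2 * R)"
          by (rule order_trans)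
      qed simp
      also have "2 * (5 * t * (4 * real n * \<sigma>^2 * (spec_norm C)^2 * R)) = 40 * n * \<sigma>^2 * (spec_norm C)^2 * R * t"
        by simp
      finally show "\<omega> \<in> ?event" using \<omega>(1) by (simp add: t_def)
    qed
    then have "prob ?good \<le> prob ?event" by (intro finite_measure_mono meas)
    moreover have "1 - exp (- t) \<le> prob ?good"
      by (rule subgaussian_sum_squares_tail[OF lin _ t])
        (auto intro!: mult_nonneg_nonneg scalar_prod_self_nonneg)
    ultimately show ?thesis unfolding exp_t by (rule order_trans[rotated])
  qed
  show ?thesis
    using first bar second unfolding A_def R_def by blast
qed

end
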